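(* (1) Let $\sigma:[0,T]\times\mathbb{R}^d\to\mathbb{R}^d$ be jointly continuous, and continuously differentiable with respect to $k$, and let $\mathcal{K}(s,t,k)$ be the flow associated with $\sigma$. Suppose that $\sigma$ is an equilibrium strategy for the intertemporal decision model. Then the function $$V(t,k)=\int_t^T h(s-t)\,u\bigl(\sigma(s,\mathcal{K}(s,t,k))\bigr)\,ds+h(T-t)\,g\bigl(\mathcal{K}(T,t,k)\bigr)$$ satisfies the integrated equilibrium equation (IE), and for all $(t,k)\in[0,T]\times\mathbb{R}^d$ $$\frac{\partial u}{\partial c}\bigl(\sigma(t,k)\bigr)=\frac{\partial V}{\partial k}(t,k).$$ (2) Conversely, if a function $V:[0,T]\times\mathbb{R}^d\to\mathbb{R}$ is twice continuously differentiable and satisfies the integrated equilibrium equation (IE), then $$\sigma(t,k)=i\Bigl(\frac{\partial V}{\partial k}(t,k)\Bigr)$$ is an equilibrium strategy for the intertemporal decision model.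
   Context: Data. $T>0$ is finite and $d\ge 1$. The discount function $h:[0,\infty)\to\mathbb{R}$ is continuously differentiable with $h(0)=1$, $h\ge 0$, $h'\le 0$ and $h(t)\to0$ as $t\to\infty$. The functions $u:\mathbb{R}^d\to\mathbb{R}$, $f:[0,T]\times\mathbb{R}^d\to\mathbb{R}^d$ and $g:\mathbb{R}^d\to\mathbb{R}$ are twice continuously differentiable; $u$ is strictly concave and $f(t,k)$ is strictly concave with respect to $k$. The derivative (gradient) $u'=\frac{\partial u}{\partial c}:\mathbb{R}^d\to\mathbb{R}^d$ has a continuously differentiable inverse $i:\mathbb{R}^d\to\mathbb{R}^d$, i.e. $u'(c)=x\iff c=i(x)$. Intertemporal decision model. The decision-maker at time $t$, with capital $k_t$, wants to maximise $$\int_t^T h(s-t)u(c(s))\,ds+h(T-t)g(k(T))\quad\text{subject to}\quad \frac{dk}{ds}=f(s,k(s))-c(s),\ k(t)=k_t.$$ Flow. For a strategy $\sigma:[0,T]\times\mathbb{R}^d\to\mathbb{R}^d$, the flow $\mathcal{K}(s,t,k)$ is the value at time $s$ of the solution of $\frac{dk}{ds}=f(s,k(s))-\sigma(s,k(s))$ which takes the value $k$ at time $t$. Solutions are taken to exist on the whole of $[t,T]$. Equilibrium strategy. Given $\sigma$, $t$, $k$ and $c\in\mathbb{R}^d$, let $k_0$ solve $\frac{dk_0}{ds}=f(s,k_0(s))-\sigma(s,k_0(s))$, $k_0(t)=k$, and let $k_1$ solve the linear equation $$\frac{dk_1}{ds}=\Bigl(\frac{\partial f}{\partial k}(s,k_0(s))-\frac{\partial\sigma}{\partial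 k}(s,k_0(s))\Bigr)k_1(s),\qquad k_1(t)=\sigma(t,k)-c,$$ where $\frac{\partial f}{\partial k},\frac{\partial\sigma}{\partial k}$ are Jacobian matrices. Put $$P_1(t,k,\sigma,c)=u(c)-u(\sigma(t,k))+\int_t^T h(s-t)\frac{\partial u}{\partial c}\bigl(\sigma(s,k_0(s))\bigr)\frac{\partial\sigma}{\partial k}(s,k_0(s))\,k_1(s)\,ds+h(T-t)\frac{\partial g}{\partial k}(k_0(T))\,k_1(T),$$ where $\frac{\partial u}{\partial c},\frac{\partial g}{\partial k}$ are gradients acting as row vectors. The strategy $\sigma$ is an equilibrium strategy if for every $t\in[0,T]$ and $k\in\mathbb{R}^d$, $\sigma(t,k)=\arg\max_{c\in\mathbb{R}^d}P_1(t,k,\sigma,c)$. Integrated equilibrium equation (IE). A function $V:[0,T]\times\mathbb{R}^d\to\mathbb{R}$ satisfies (IE) if for every $t\in[0,T]$ and every $k\in\mathbb{R}^d$ $$V(t,k)=\int_t^T h(s-t)\,u\Bigl(i\bigl(\tfrac{\partial V}{\partial k}(s,k_0(s))\bigr)\Bigr)ds+h(T-t)\,g(k_0(T)),$$ where $k_0$ solves $\frac{dk_0}{ds}=f(s,k_0(s))-i\bigl(\frac{\partial V}{\partial k}(s,k_0(s))\bigr)$, $k_0(t)=k$. *)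

theory Defs
  imports "HOL-Analysis.Analysis"
begin

text \<open>
  \<open>\<real>^d\<close> is \<open>real ^ 'd\<close>. A function on \<open>[0,T] \<times> \<real>^d\<close> is represented by a
  curried total function; only its values at times in \<open>{0..T}\<close> are ever used.
\<close>

text \<open>
  Derivatives are taken within \<open>S\<close>, so they are one-sided at the end points of the time interval
  when \<open>S = {0..T} \<times> UNIV\<close>.
\<close>

definition C1_on :: "'a::real_normed_vector set \<Rightarrow> ('a \<Rightarrow> 'b::real_normed_vector) \<Rightarrow> bool" where
  "C1_on S F \<longleftrightarrow>
     (\<exists>F' :: 'a \<Rightarrow> 'a \<Rightarrow>\<^sub>L 'b.
        (\<forall>x\<in>S. (F has_derivative blinfun_apply (F' x)) (at x within S)) \<and> continuous_on S F')"

definition C2_on :: "'a::real_normed_vector set \<Rightarrow> ('a \<Rightarrow> 'b::real_normed_vector) \<Rightarrow> bool" where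
  "C2_on S F \<longleftrightarrow>
     (\<exists>F' :: 'a \<Rightarrow> 'a \<Rightarrow>\<^sub>L 'b.
        (\<forall>x\<in>S. (F has_derivative blinfun_apply (F' x)) (at x within S)) \<and> C1_on S F')"

definition strictly_concave :: "('a::real_vector \<Rightarrow> real) \<Rightarrow> bool" where
  "strictly_concave F \<longleftrightarrow>
     (\<forall>x y. \<forall>\<theta>. x \<noteq> y \<longrightarrow> 0 < \<theta> \<longrightarrow> \<theta> < 1 \<longrightarrow>
        (1 - \<theta>) * F x + \<theta> * F y < F ((1 - \<theta>) *\<^sub>R x + \<theta> *\<^sub>R y))"

text \<open>Only meaningful where \<open>F\<close> is differentiable; there the vector is unique.\<close>

definition gradient :: "('a::real_inner \<Rightarrow> real) \<Rightarrow> 'a \<Rightarrow> 'a" where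
  "gradient F x = (THE D. GDERIV F x :> D)"

text \<open>The classical solution of \<open>x' = F(s, x)\<close>, \<open>x(t) = x\<^sub>0\<close> on all of \<open>[t, T]\<close>.\<close>

definition ivp_solution ::
  "(real \<Rightarrow> 'a::real_normed_vector \<Rightarrow> 'a) \<Rightarrow> real \<Rightarrow> real \<Rightarrow> 'a \<Rightarrow> (real \<Rightarrow> 'a) \<Rightarrow> bool" where
  "ivp_solution F t T x0 x \<longleftrightarrow>
     x t = x0 \<and> (\<forall>s\<in>{t..T}. (x has_vector_derivative F s (x s)) (at s within {t..T}))"

definition state_path ::
  "real \<Rightarrow> (real \<Rightarrow> real ^ 'd \<Rightarrow> real ^ 'd) \<Rightarrow> (real \<Rightarrow> real ^ 'd \<Rightarrow> real ^ 'd) \<Rightarrow>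
   real \<Rightarrow> real ^ 'd \<Rightarrow> (real \<Rightarrow> real ^ 'd) \<Rightarrow> bool" where
  "state_path T f \<sigma> t k k0 \<longleftrightarrow> ivp_solution (\<lambda>s x. f s x - \<sigma> s x) t T k k0"

definition is_flow ::
  "real \<Rightarrow> (real \<Rightarrow> real ^ 'd \<Rightarrow> real ^ 'd) \<Rightarrow> (real \<Rightarrow> real ^ 'd \<Rightarrow> real ^ 'd) \<Rightarrow>
   (real \<Rightarrow> real \<Rightarrow> real ^ 'd \<Rightarrow> real ^ 'd) \<Rightarrow> bool" where
  "is_flow T f \<sigma> K \<longleftrightarrow> (\<forall>t\<in>{0..T}. \<forall>k. state_path T f \<sigma> t k (\<lambda>s. K s t k))"

definition linearised_path ::
  "real \<Rightarrow> (real \<Rightarrow> real ^ 'd \<Rightarrow> real ^ 'd) \<Rightarrow> (real \<Rightarrow> real ^ 'd \<Rightarrow> real ^ 'd) \<Rightarrow>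
   real \<Rightarrow> real ^ 'd \<Rightarrow> real ^ 'd \<Rightarrow> (real \<Rightarrow> real ^ 'd) \<Rightarrow> (real \<Rightarrow> real ^ 'd) \<Rightarrow> bool" where
  "linearised_path T f \<sigma> t k c k0 k1 \<longleftrightarrow>
     ivp_solution (\<lambda>s x. (jacobian (f s) (at (k0 s)) - jacobian (\<sigma> s) (at (k0 s))) *v x)
       t T (\<sigma> t k - c) k1"

definition P1_integrand ::
  "(real \<Rightarrow> real) \<Rightarrow> (real ^ 'd \<Rightarrow> real) \<Rightarrow> (real \<Rightarrow> real ^ 'd \<Rightarrow> real ^ 'd) \<Rightarrow>
   real \<Rightarrow> (real \<Rightarrow> real ^ 'd) \<Rightarrow> (real \<Rightarrow> real ^ 'd) \<Rightarrow> real \<Rightarrow> real" where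
  "P1_integrand h u \<sigma> t k0 k1 s =
     h (s - t) * ((gradient u (\<sigma> s (k0 s)) v* jacobian (\<sigma> s) (at (k0 s))) \<bullet> k1 s)"

definition P1 ::
  "real \<Rightarrow> (real \<Rightarrow> real) \<Rightarrow> (real ^ 'd \<Rightarrow> real) \<Rightarrow> (real ^ 'd \<Rightarrow> real) \<Rightarrow>
   (real \<Rightarrow> real ^ 'd \<Rightarrow> real ^ 'd) \<Rightarrow> (real \<Rightarrow> real ^ 'd) \<Rightarrow> (real \<Rightarrow> real ^ 'd) \<Rightarrow>
   real \<Rightarrow> real ^ 'd \<Rightarrow> real ^ 'd \<Rightarrow> real" where
  "P1 T h u g \<sigma> k0 k1 t k c =
     u c - u (\<sigma> t k) + integral {t..T} (P1_integrand h u \<sigma> t k0 k1)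
     + h (T - t) * (gradient g (k0 T) \<bullet> k1 T)"

text \<open>
  The paths \<open>k0\<close> and \<open>k1\<close> (the latter depending on the deviation \<open>c\<close>) are unique on \<open>[t, T]\<close> as soon
  as \<open>f\<close> and \<open>\<sigma>\<close> are continuously differentiable in \<open>k\<close>; the definition asks that they exist and that
  the condition holds for every choice of them. Differentiability of \<open>\<sigma>\<close> in \<open>k\<close> and integrability are
  included so that \<open>P1\<close> never involves an undefined Jacobian or integral. The last line says that
  \<open>\<sigma>(t, k)\<close> is the one and only maximiser of \<open>P1\<close> over all of \<open>\<real>^d\<close>.
\<close>

definition equilibrium_strategy ::
  "real \<Rightarrow> (real \<Rightarrow> real) \<Rightarrow> (real ^ 'd \<Rightarrow> real) \<Rightarrow> (real \<Rightarrow> real ^ 'd \<Rightarrow> real ^ 'd) \<Rightarrow>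
   (real ^ 'd \<Rightarrow> real) \<Rightarrow> (real \<Rightarrow> real ^ 'd \<Rightarrow> real ^ 'd) \<Rightarrow> bool" where
  "equilibrium_strategy T h u f g \<sigma> \<longleftrightarrow>
     (\<forall>t\<in>{0..T}. \<forall>k. \<sigma> t differentiable (at k)) \<and>
     (\<forall>t\<in>{0..T}. \<forall>k.
        (\<exists>k0. state_path T f \<sigma> t k k0) \<and>
        (\<forall>k0. state_path T f \<sigma> t k k0 \<longrightarrow>
           (\<forall>c. \<exists>k1. linearised_path T f \<sigma> t k c k0 k1) \<and>
           (\<forall>k1. (\<forall>c. linearised_path T f \<sigma> t k c k0 (k1 c)) \<longrightarrow>
              (\<forall>c. P1_integrand h u \<sigma> t k0 (k1 c) integrable_on {t..T}) \<and>
              (\<forall>c. is_arg_max (\<lambda>c. P1 T h u g \<sigma> k0 (k1 c) t k c) (\<lambda>_. True) c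
                     \<longleftrightarrow> c = \<sigma> t k))))"

text \<open>
  The path \<open>k0\<close> here is the state path of the strategy \<open>i(\<partial>V/\<partial>k)\<close>. As above, its existence,
  differentiability of \<open>V\<close> in \<open>k\<close> and integrability are part of the equation being meaningful.
\<close>

definition satisfies_IE ::
  "real \<Rightarrow> (real \<Rightarrow> real) \<Rightarrow> (real ^ 'd \<Rightarrow> real) \<Rightarrow> (real \<Rightarrow> real ^ 'd \<Rightarrow> real ^ 'd) \<Rightarrow>
   (real ^ 'd \<Rightarrow> real) \<Rightarrow> (real ^ 'd \<Rightarrow> real ^ 'd) \<Rightarrow> (real \<Rightarrow> real ^ 'd \<Rightarrow> real) \<Rightarrow> bool" where
  "satisfies_IE T h u f g i V \<longleftrightarrow>
     (\<forall>t\<in>{0..T}. \<forall>k. V t differentiable (at k)) \<and>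
     (\<forall>t\<in>{0..T}. \<forall>k.
        (\<exists>k0. state_path T f (\<lambda>s x. i (gradient (V s) x)) t k k0) \<and>
        (\<forall>k0. state_path T f (\<lambda>s x. i (gradient (V s) x)) t k k0 \<longrightarrow>
           (\<lambda>s. h (s - t) * u (i (gradient (V s) (k0 s)))) integrable_on {t..T} \<and>
           V t k = integral {t..T} (\<lambda>s. h (s - t) * u (i (gradient (V s) (k0 s))))
                   + h (T - t) * g (k0 T)))"

definition value_function ::
  "real \<Rightarrow> (real \<Rightarrow> real) \<Rightarrow> (real ^ 'd \<Rightarrow> real) \<Rightarrow> (real ^ 'd \<Rightarrow> real) \<Rightarrow>
   (real \<Rightarrow> real ^ 'd \<Rightarrow> real ^ 'd) \<Rightarrow> (real \<Rightarrow> real \<Rightarrow> real ^ 'd \<Rightarrow> real ^ 'd) \<Rightarrow>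
   real \<Rightarrow> real ^ 'd \<Rightarrow> real" where
  "value_function T h u g \<sigma> K t k =
     integral {t..T} (\<lambda>s. h (s - t) * u (\<sigma> s (K s t k))) + h (T - t) * g (K T t k)"

end

theory Submission
  imports Defs
begin


text \<open>
  Fix a strategy \<open>\<sigma>\<close> that is continuously differentiable in the capital, with flow \<open>K\<close>, and let \<open>V\<close>
  be its value function. Differentiating the flow with respect to its initial value \<open>k\<close> in the
  direction \<open>w\<close> gives the solution of the variational equation that starts from \<open>w\<close>; and \<open>k\<^sub>1\<close> is this
  solution for \<open>w = \<sigma>(t,k) - c\<close>. Differentiating \<open>V\<close> under the integral sign therefore produces
  exactly the last two terms of \<open>P\<^sub>1\<close>:
  \<open>P\<^sub>1(t,k,\<sigma>,c) = u(c) - u(\<sigma>(t,k)) - \<nabla>V(t,k) \<bullet> (c - \<sigma>(t,k))\<close>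
  (\<open>value_function_derivative\<close>), where \<open>\<nabla>V\<close> is the gradient in \<open>k\<close>. Both parts follow from this identity.

  If \<open>\<sigma>(t,k)\<close> maximises the right-hand side, the first order condition is
  \<open>\<nabla>u(\<sigma>(t,k)) = \<nabla>V(t,k)\<close>. Hence \<open>\<sigma> = i(\<nabla>V)\<close>, and the definition of \<open>V\<close> becomes the integrated
  equation.

  Conversely, suppose that \<open>V\<close> solves the integrated equation and put \<open>\<sigma> = i(\<nabla>V)\<close>. The equation says
  that \<open>V\<close> is the value function of \<open>\<sigma>\<close>, and the definition of \<open>i\<close> says that \<open>\<nabla>u(\<sigma>) = \<nabla>V\<close>. By the
  identity, \<open>P\<^sub>1\<close> is the difference at \<open>c\<close> between \<open>u\<close> and its tangent at \<open>\<sigma>(t,k)\<close>. As \<open>u\<close> is strictly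
  concave, this is negative unless \<open>c = \<sigma>(t,k)\<close>.

  The analytic core is the differentiability of the flow in its initial value. All the estimates come
  from one Gronwall inequality: nearby solutions stay in a tube around a given one
  (\<open>solution_stability\<close>), the variational equation is solvable because the difference quotients of
  the flow form a uniform Cauchy sequence (\<open>variational_solution_exists\<close>), and the flow is
  differentiable uniformly in time (\<open>solution_linearisation\<close>), so that one may differentiate under the
  integral (\<open>payoff_derivative\<close>).
\<close>

section \<open>A Gronwall inequality\<close>

text \<open>
  The estimate is made for the squared norm, which unlike the norm is differentiable everywhere. This
  costs a larger exponent, but only the linear dependence on \<open>norm (z a) + \<eta>\<close> matters below. The
  differential inequality is needed only inside the interval.
\<close>

lemma gronwall:
  fixes z z' :: "real \<Rightarrow> 'a::real_inner"
  assumes L: "0 \<le> L" and eta: "0 \<le> \<eta>"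
    and cont: "continuous_on {a..b} z"
    and der: "\<And>s. a < s \<Longrightarrow> s < b \<Longrightarrow> (z has_vector_derivative z' s) (at s)"
    and bnd: "\<And>s. a < s \<Longrightarrow> s < b \<Longrightarrow> norm (z' s) \<le> L * norm (z s) + \<eta>"
    and s: "s \<in> {a..b}"
  shows "norm (z s) \<le> exp ((L + 1) * (b - a)) * (norm (z a) + \<eta>)"
proof -
  define \<phi> where "\<phi> r = exp (- ((2 * L + 1) * (r - a))) * (z r \<bullet> z r + \<eta>\<^sup>2)" for r
  have "\<phi> s \<le> \<phi> a"
  proof (rule DERIV_nonpos_imp_decreasing_open[where f = \<phi> and a = a and b = s])
    show "a \<le> s" using s by simp
    show "continuous_on {a..s} \<phi>"
      unfolding \<phi>_def using s
      by (intro continuous_intros continuous_on_subset[OF cont]) auto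
    fix r assume r: "a < r" "r < s"
    then have rb: "r < b" using s by simp
    have zd: "(z has_derivative (\<lambda>h. h *\<^sub>R z' r)) (at r)"
      using der[OF r(1) rb] by (simp add: has_vector_derivative_def)
    have "((\<lambda>r. z r \<bullet> z r) has_derivative (\<lambda>h. z r \<bullet> (h *\<^sub>R z' r) + (h *\<^sub>R z' r) \<bullet> z r)) (at r)"
      by (rule has_derivative_inner[OF zd zd])
    then have ip: "((\<lambda>r. z r \<bullet> z r) has_real_derivative 2 * (z r \<bullet> z' r)) (at r)"
      by (rule has_derivative_imp_has_field_derivative) (simp add: inner_commute algebra_simps)
    have "(\<phi> has_real_derivative exp (- ((2 * L + 1) * (r - a))) *
        (2 * (z r \<bullet> z' r) - (2 * L + 1) * (z r \<bullet> z r + \<eta>\<^sup>2))) (at r)"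
      unfolding \<phi>_def by (rule derivative_eq_intros ip refl)+ (simp add: algebra_simps)
    moreover have "2 * (z r \<bullet> z' r) \<le> (2 * L + 1) * (z r \<bullet> z r + \<eta>\<^sup>2)"
    proof -
      have "z r \<bullet> z' r \<le> norm (z r) * norm (z' r)" by (rule norm_cauchy_schwarz)
      also have "\<dots> \<le> norm (z r) * (L * norm (z r) + \<eta>)"
        by (intro mult_left_mono bnd r rb) simp
      finally have "2 * (z r \<bullet> z' r) \<le> 2 * L * (norm (z r))\<^sup>2 + 2 * norm (z r) * \<eta>"
        by (simp add: algebra_simps power2_eq_square)
      also have "2 * norm (z r) * \<eta> \<le> (norm (z r))\<^sup>2 + \<eta>\<^sup>2"
        using sum_squares_bound[of "norm (z r)" \<eta>] by simp
      finally have "2 * (z r \<bullet> z' r) \<le> (2 * L + 1) * (norm (z r))\<^sup>2 + \<eta>\<^sup>2"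
        by (simp add: algebra_simps)
      moreover have "0 \<le> 2 * L * \<eta>\<^sup>2" using L by simp
      ultimately show ?thesis by (simp add: algebra_simps power2_norm_eq_inner)
    qed
    ultimately show "\<exists>y. (\<phi> has_real_derivative y) (at r) \<and> y \<le> 0"
      by (intro exI conjI) (auto simp: mult_nonneg_nonpos)
  qed
  then have "exp (- ((2 * L + 1) * (s - a))) * ((norm (z s))\<^sup>2 + \<eta>\<^sup>2) \<le> (norm (z a))\<^sup>2 + \<eta>\<^sup>2"
    by (simp add: \<phi>_def power2_norm_eq_inner)
  moreover have "A \<le> exp r * B" if "exp (- r) * A \<le> B" for r A B :: real
    using that by (simp add: exp_minus field_simps)
  ultimately have "(norm (z s))\<^sup>2 + \<eta>\<^sup>2 \<le> exp ((2 * L + 1) * (s - a)) * ((norm (z a))\<^sup>2 + \<eta>\<^sup>2)"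
    by blast
  also have "\<dots> \<le> exp (2 * ((L + 1) * (b - a))) * (norm (z a) + \<eta>)\<^sup>2"
  proof (rule mult_mono)
    have "(2 * L + 1) * (s - a) \<le> (2 * L + 2) * (b - a)"
      using s L by (intro mult_mono) auto
    then show "exp ((2 * L + 1) * (s - a)) \<le> exp (2 * ((L + 1) * (b - a)))"
      by (simp add: algebra_simps)
    show "(norm (z a))\<^sup>2 + \<eta>\<^sup>2 \<le> (norm (z a) + \<eta>)\<^sup>2"
      using eta by (simp add: power2_sum)
  qed auto
  also have "\<dots> = (exp ((L + 1) * (b - a)) * (norm (z a) + \<eta>))\<^sup>2"
    by (simp add: power_mult_distrib exp_double)
  finally have "(norm (z s))\<^sup>2 \<le> (exp ((L + 1) * (b - a)) * (norm (z a) + \<eta>))\<^sup>2"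
    using zero_le_power2[of \<eta>] by linarith
  then show ?thesis
    by (rule power2_le_imp_le) (use eta in auto)
qed

section \<open>Differential equations with a continuously differentiable field\<close>

lemma ivp_solution_initial: "ivp_solution F t T x0 x \<Longrightarrow> x t = x0"
  by (simp add: ivp_solution_def)

lemma ivp_solution_continuous:
  "ivp_solution F t T x0 x \<Longrightarrow> continuous_on {t..T} x"
  unfolding ivp_solution_def
  by (rule continuous_on_vector_derivative[where f' = "\<lambda>s. F s (x s)"]) auto

lemma ivp_solution_derivative:
  "ivp_solution F t T x0 x \<Longrightarrow> t < s \<Longrightarrow> s < T \<Longrightarrow> (x has_vector_derivative F s (x s)) (at s)"
  unfolding ivp_solution_def
  by (metis at_within_Icc_at atLeastAtMost_iff less_imp_le)

lemma ivp_solution_cong: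
  assumes "\<And>s. s \<in> {t..T} \<Longrightarrow> F s (x s) = G s (x s)"
  shows "ivp_solution F t T x0 x \<longleftrightarrow> ivp_solution G t T x0 x"
  using assms by (simp add: ivp_solution_def)

lemma continuous_on_along_path:
  fixes G :: "real \<Rightarrow> 'a::topological_space \<Rightarrow> 'b::topological_space"
  assumes G: "continuous_on (I \<times> UNIV) (\<lambda>(s, x). G s x)" and y: "continuous_on I y"
  shows "continuous_on I (\<lambda>s. G s (y s))"
proof -
  have "continuous_on I (\<lambda>s. (s, y s))" by (intro continuous_intros y)
  from continuous_on_compose2[OF G this] show ?thesis by (simp add: image_subset_iff)
qed

text \<open>
  First-order Taylor approximation along a path, with an error that is uniform in time: the derivative
  is uniformly continuous on a compact tube around the path, and the mean value inequality applies.
\<close>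

lemma uniform_remainder:
  fixes G :: "real \<Rightarrow> 'a::euclidean_space \<Rightarrow> 'b::real_normed_vector"
  assumes contD: "continuous_on ({a..b} \<times> UNIV) (\<lambda>(s, x). D s x)"
    and der: "\<And>s x. s \<in> {a..b} \<Longrightarrow> (G s has_derivative blinfun_apply (D s x)) (at x)"
    and conty: "continuous_on {a..b} y" and e: "0 < e"
  obtains \<delta> where "0 < \<delta>"
    "\<And>s v. s \<in> {a..b} \<Longrightarrow> norm v \<le> \<delta> \<Longrightarrow>
       norm (G s (y s + v) - G s (y s) - D s (y s) v) \<le> e * norm v"
proof -
  have "bounded (y ` {a..b})"
    by (intro compact_imp_bounded compact_continuous_image conty compact_Icc)
  then obtain R where R: "\<And>s. s \<in> {a..b} \<Longrightarrow> norm (y s) \<le> R"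
    unfolding bounded_iff by blast
  define C where "C = {a..b} \<times> cball (0::'a) (R + 1)"
  have "compact C" unfolding C_def by (intro compact_Times compact_Icc compact_cball)
  moreover have "continuous_on C (\<lambda>(s, x). D s x)"
    by (rule continuous_on_subset[OF contD]) (auto simp: C_def)
  ultimately have "uniformly_continuous_on C (\<lambda>(s, x). D s x)"
    by (rule compact_uniformly_continuous[rotated])
  then obtain d where d: "0 < d"
    and dC: "\<And>p q. p \<in> C \<Longrightarrow> q \<in> C \<Longrightarrow> dist p q < d \<Longrightarrow>
        dist ((\<lambda>(s, x). D s x) p) ((\<lambda>(s, x). D s x) q) < e"
    using e unfolding uniformly_continuous_on_def by metis
  define \<delta> where "\<delta> = min 1 (d / 2)"
  show thesis
  proof (rule that[of \<delta>])
    show "0 < \<delta>" using d by (simp add: \<delta>_def)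
    fix s and v :: 'a assume s: "s \<in> {a..b}" and v: "norm v \<le> \<delta>"
    have mem: "(s, y s + w) \<in> C" if "norm w \<le> \<delta>" for w
    proof -
      have "norm (y s + w) \<le> R + 1"
        using norm_triangle_ineq[of "y s" w] R[OF s] that by (simp add: \<delta>_def)
      then show ?thesis using s by (simp add: C_def)
    qed
    have "norm (G s (y s + v) - G s (y s) - D s (y s) ((y s + v) - y s)) \<le> norm ((y s + v) - y s) * e"
    proof (rule differentiable_bound_linearization[where S = "cball (y s) \<delta>"])
      show "y s + r *\<^sub>R (y s + v - y s) \<in> cball (y s) \<delta>" if "r \<in> {0..1}" for r
        using that v mult_right_mono[of r 1 "norm v"] by (simp add: dist_norm)
      show "(G s has_derivative blinfun_apply (D s x)) (at x within cball (y s) \<delta>)" for x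
        using der[OF s] has_derivative_at_withinI by blast
      show "y s \<in> cball (y s) \<delta>" using order_trans[OF norm_ge_zero v] by simp
      fix x assume x: "x \<in> cball (y s) \<delta>"
      have "dist (s, x) (s, y s) < d"
        using x d by (auto simp: dist_Pair_Pair \<delta>_def dist_commute)
      moreover have "(s, x) \<in> C"
        using mem[of "x - y s"] x by (simp add: dist_norm norm_minus_commute)
      moreover have "(s, y s) \<in> C" using mem[of 0] order_trans[OF norm_ge_zero v] by simp
      ultimately have "dist (D s x) (D s (y s)) < e" using dC[of "(s, x)" "(s, y s)"] by simp
      then show "onorm (blinfun_apply (D s x) - blinfun_apply (D s (y s))) \<le> e"
        by (simp add: fun_diff_def dist_norm norm_blinfun.rep_eq minus_blinfun.rep_eq)
    qed
    then show "norm (G s (y s + v) - G s (y s) - D s (y s) v) \<le> e * norm v"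
      by (simp add: mult.commute)
  qed
qed

text \<open>
  A time-dependent vector field \<open>F\<close> on the whole space, differentiable in the space variable with
  jointly continuous derivative \<open>D\<close>. No regularity in time is required of \<open>F\<close> itself.
\<close>

locale C1_field =
  fixes a b :: real
    and F :: "real \<Rightarrow> 'a::euclidean_space \<Rightarrow> 'a"
    and D :: "real \<Rightarrow> 'a \<Rightarrow> 'a \<Rightarrow>\<^sub>L 'a"
  assumes ab: "a \<le> b"
    and D_cont: "continuous_on ({a..b} \<times> UNIV) (\<lambda>(s, x). D s x)"
    and F_deriv: "\<And>s x. s \<in> {a..b} \<Longrightarrow> (F s has_derivative blinfun_apply (D s x)) (at x)"
begin

lemma D_along_cont:
  assumes "continuous_on {a..b} x"
  shows "continuous_on {a..b} (\<lambda>s. D s (x s))"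
  by (rule continuous_on_along_path[OF D_cont assms])

lemma D_along_bounded:
  assumes "continuous_on {a..b} x"
  obtains M where "0 \<le> M" "\<And>s v. s \<in> {a..b} \<Longrightarrow> norm (D s (x s) v) \<le> M * norm v"
proof -
  have "bounded ((\<lambda>s. D s (x s)) ` {a..b})"
    by (intro compact_imp_bounded compact_continuous_image D_along_cont assms compact_Icc)
  then obtain M where M: "\<And>s. s \<in> {a..b} \<Longrightarrow> norm (D s (x s)) \<le> M"
    unfolding bounded_iff by blast
  show thesis
  proof (rule that[of "max 0 M"])
    fix s and v :: 'a assume "s \<in> {a..b}"
    then have "norm (D s (x s)) * norm v \<le> max 0 M * norm v"
      by (intro mult_right_mono) (auto simp: M le_max_iff_disj)
    then show "norm (D s (x s) v) \<le> max 0 M * norm v"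
      using norm_blinfun[of "D s (x s)" v] by linarith
  qed simp
qed

text \<open>
  Near a given solution \<open>x\<close> the field is Lipschitz, but only in a tube of some radius \<open>\<rho>\<close>. A solution
  that starts close enough to \<open>x\<close> cannot leave the tube: at the first exit time Gronwall's inequality
  would bound its distance to \<open>x\<close> by less than \<open>\<rho>\<close>.
\<close>

lemma solution_stability:
  assumes x: "ivp_solution F a b x0 x"
  obtains C \<delta> where "0 \<le> C" "0 < \<delta>"
    "\<And>y0 y s. ivp_solution F a b y0 y \<Longrightarrow> norm (y0 - x0) \<le> \<delta> \<Longrightarrow> s \<in> {a..b} \<Longrightarrow>
       norm (y s - x s) \<le> C * norm (y0 - x0)"
proof -
  note xc = ivp_solution_continuous[OF x]
  obtain \<rho> where \<rho>: "0 < \<rho>"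
    and rem: "\<And>s v. s \<in> {a..b} \<Longrightarrow> norm v \<le> \<rho> \<Longrightarrow>
       norm (F s (x s + v) - F s (x s) - D s (x s) v) \<le> 1 * norm v"
    using uniform_remainder[OF D_cont F_deriv xc zero_less_one] by blast
  obtain M where M: "0 \<le> M" "\<And>s v. s \<in> {a..b} \<Longrightarrow> norm (D s (x s) v) \<le> M * norm v"
    using D_along_bounded[OF xc] by blast
  define C where "C = exp ((M + 1 + 1) * (b - a))"
  have C: "1 \<le> C" using M(1) ab by (simp add: C_def)
  show thesis
  proof (rule that[of C "\<rho> / (2 * C)"])
    show "0 \<le> C" "0 < \<rho> / (2 * C)" using C \<rho> by auto
    fix y0 y s
    assume y: "ivp_solution F a b y0 y" and y0: "norm (y0 - x0) \<le> \<rho> / (2 * C)" and s: "s \<in> {a..b}"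
    define z where "z s = y s - x s" for s
    have za: "z a = y0 - x0"
      using x y by (simp add: z_def ivp_solution_initial)
    have zc: "continuous_on {a..b} z"
      unfolding z_def by (intro continuous_intros ivp_solution_continuous[OF x] ivp_solution_continuous[OF y])
    have zd: "(z has_vector_derivative F s (y s) - F s (x s)) (at s)" if "a < s" "s < b" for s
      unfolding z_def
      by (intro has_vector_derivative_diff ivp_solution_derivative[OF x] ivp_solution_derivative[OF y] that)
    have zb: "norm (F s (y s) - F s (x s)) \<le> (M + 1) * norm (z s) + 0"
      if "a < s" "s < b" "norm (z s) < \<rho>" for s
    proof -
      have "norm (F s (x s + z s) - F s (x s) - D s (x s) (z s)) \<le> 1 * norm (z s)"
        using that by (intro rem) auto
      moreover have "norm (D s (x s) (z s)) \<le> M * norm (z s)" using that by (intro M) auto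
      ultimately show ?thesis
        using norm_triangle_sub[of "F s (y s) - F s (x s)" "D s (x s) (z s)"]
        by (simp add: z_def algebra_simps)
    qed
    have est: "norm (z r) \<le> C * norm (z a)"
      if r: "r \<in> {a..b}" and small: "\<And>s. a \<le> s \<Longrightarrow> s < r \<Longrightarrow> norm (z s) < \<rho>" for r
    proof -
      have "norm (z r) \<le> exp ((M + 1 + 1) * (r - a)) * (norm (z a) + 0)"
        by (rule gronwall[where b = r and z' = "\<lambda>s. F s (y s) - F s (x s)" and L = "M + 1"])
           (use r M(1) small in \<open>auto intro!: zd zb[simplified] continuous_on_subset[OF zc]\<close>)
      also have "\<dots> \<le> C * (norm (z a) + 0)"
        unfolding C_def using r M(1) by (intro mult_right_mono) (auto intro: mult_left_mono)
      finally show ?thesis by simp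
    qed
    have small: "norm (z s) < \<rho>" if "s \<in> {a..b}" for s
    proof (rule ccontr)
      assume "\<not> norm (z s) < \<rho>"
      define S where "S = {s \<in> {a..b}. norm (z s) \<in> {\<rho>..}}"
      have "closed S"
        unfolding S_def
        by (rule continuous_closed_preimage[unfolded vimage_def Int_def, simplified mem_Collect_eq])
           (auto intro!: continuous_intros zc)
      then have "compact S"
        using compact_Int_closed[of "{a..b}" S] by (simp add: S_def Int_def conj_assoc cong: conj_cong)
      moreover have "s \<in> S" using that \<open>\<not> norm (z s) < \<rho>\<close> by (simp add: S_def)
      \<comment> \<open>the first exit time from the tube\<close>
      ultimately obtain \<tau> where \<tau>: "\<tau> \<in> S" "\<And>s. s \<in> S \<Longrightarrow> \<tau> \<le> s"
        using compact_attains_inf[of S] by auto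
      have "norm (z \<tau>) \<le> C * norm (z a)"
      proof (rule est)
        show "\<tau> \<in> {a..b}" using \<tau> by (simp add: S_def)
        show "norm (z s) < \<rho>" if "a \<le> s" "s < \<tau>" for s
          using \<tau>(2)[of s] that \<tau>(1) by (fastforce simp: S_def)
      qed
      also have "\<dots> \<le> C * (\<rho> / (2 * C))" using y0 C za by (intro mult_left_mono) auto
      also have "\<dots> < \<rho>" using C \<rho> by simp
      finally show False using \<tau>(1) by (simp add: S_def)
    qed
    have "norm (z s) \<le> C * norm (z a)" using s small by (intro est) auto
    then show "norm (y s - x s) \<le> C * norm (y0 - x0)" using za by (simp add: z_def)
  qed
qed

lemma solution_unique:
  assumes x: "ivp_solution F a b x0 x" and y: "ivp_solution F a b x0 y" and s: "s \<in> {a..b}"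
  shows "y s = x s"
proof -
  obtain C \<delta> where "0 < \<delta>"
    "\<And>y0 y s. ivp_solution F a b y0 y \<Longrightarrow> norm (y0 - x0) \<le> \<delta> \<Longrightarrow> s \<in> {a..b} \<Longrightarrow>
       norm (y s - x s) \<le> C * norm (y0 - x0)"
    using solution_stability[OF x] by metis
  from this(2)[OF y _ s] this(1) show ?thesis by simp
qed

end

section \<open>The variational equation\<close>

context C1_field
begin

text \<open>The linearisation along the path \<open>x\<close> of the equation with field \<open>F\<close>, with initial value \<open>w\<close>.\<close>

definition variational_solution :: "(real \<Rightarrow> 'a) \<Rightarrow> 'a \<Rightarrow> (real \<Rightarrow> 'a) \<Rightarrow> bool" where
  "variational_solution x w Y \<longleftrightarrow> ivp_solution (\<lambda>s v. D s (x s) v) a b w Y"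

lemma variational_solution_unique:
  assumes x: "continuous_on {a..b} x"
    and Y: "variational_solution x w Y" and Z: "variational_solution x w Z" and s: "s \<in> {a..b}"
  shows "Z s = Y s"
proof -
  \<comment> \<open>the variational equation is itself driven by a continuously differentiable field\<close>
  interpret lin: C1_field a b "\<lambda>s v. D s (x s) v" "\<lambda>s v. D s (x s)"
  proof
    have "continuous_on ({a..b} \<times> (UNIV :: 'a set)) (\<lambda>p. D (fst p) (x (fst p)))"
      by (rule continuous_on_compose2[OF D_along_cont[OF x] continuous_on_fst[OF continuous_on_id]]) auto
    then show "continuous_on ({a..b} \<times> UNIV) (\<lambda>(s, v :: 'a). D s (x s))"
      by (simp add: case_prod_unfold)
  qed (simp_all add: ab blinfun.bounded_linear_right bounded_linear_imp_has_derivative)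
  show ?thesis
    using lin.solution_unique Y Z s unfolding variational_solution_def by blast
qed

lemma variational_solution_linear:
  assumes "variational_solution x v Y" "variational_solution x w Z"
  shows "variational_solution x (r *\<^sub>R v + q *\<^sub>R w) (\<lambda>s. r *\<^sub>R Y s + q *\<^sub>R Z s)"
  using assms unfolding variational_solution_def ivp_solution_def
  by (auto simp: blinfun.add_right blinfun.scaleR_right
      intro!: has_vector_derivative_add bounded_linear.has_vector_derivative[OF bounded_linear_scaleR_right])

text \<open>
  The difference of two nearby solutions satisfies the variational equation up to an error that is
  small compared with the difference of the initial values.
\<close>

lemma solution_expansion:
  assumes x: "ivp_solution F a b x0 x"
  obtains C where "0 \<le> C"
    "\<And>e. 0 < e \<Longrightarrow> \<exists>\<delta>>0. \<forall>y0 y. ivp_solution F a b y0 y \<longrightarrow> norm (y0 - x0) \<le> \<delta> \<longrightarrow>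
       (\<forall>s\<in>{a..b}. norm (y s - x s) \<le> C * norm (y0 - x0) \<and>
          norm (F s (y s) - F s (x s) - D s (x s) (y s - x s)) \<le> e * norm (y0 - x0))"
proof -
  obtain C \<delta>0 where C: "0 \<le> C" and \<delta>0: "0 < \<delta>0"
    and st: "\<And>y0 y s. ivp_solution F a b y0 y \<Longrightarrow> norm (y0 - x0) \<le> \<delta>0 \<Longrightarrow> s \<in> {a..b} \<Longrightarrow>
       norm (y s - x s) \<le> C * norm (y0 - x0)"
    using solution_stability[OF x] by metis
  show thesis
  proof (rule that[OF C])
    fix e :: real assume e: "0 < e"
    have e': "0 < e / (C + 1)" using C e by simp
    obtain \<delta>1 where \<delta>1: "0 < \<delta>1"
      and rem: "\<And>s v. s \<in> {a..b} \<Longrightarrow> norm v \<le> \<delta>1 \<Longrightarrow>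
         norm (F s (x s + v) - F s (x s) - D s (x s) v) \<le> e / (C + 1) * norm v"
      using uniform_remainder[OF D_cont F_deriv ivp_solution_continuous[OF x] e'] by blast
    define \<delta> where "\<delta> = min \<delta>0 (\<delta>1 / (C + 1))"
    show "\<exists>\<delta>>0. \<forall>y0 y. ivp_solution F a b y0 y \<longrightarrow> norm (y0 - x0) \<le> \<delta> \<longrightarrow>
       (\<forall>s\<in>{a..b}. norm (y s - x s) \<le> C * norm (y0 - x0) \<and>
          norm (F s (y s) - F s (x s) - D s (x s) (y s - x s)) \<le> e * norm (y0 - x0))"
    proof (intro exI[of _ \<delta>] conjI allI impI ballI)
      show "0 < \<delta>" using \<delta>0 \<delta>1 C by (simp add: \<delta>_def)
      fix y0 y s
      assume y: "ivp_solution F a b y0 y" and y0: "norm (y0 - x0) \<le> \<delta>" and s: "s \<in> {a..b}"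
      show 1: "norm (y s - x s) \<le> C * norm (y0 - x0)"
        using st[OF y _ s] y0 by (simp add: \<delta>_def)
      also have 2: "\<dots> \<le> (C + 1) * norm (y0 - x0)" by (simp add: mult_right_mono)
      also have "\<dots> \<le> (C + 1) * (\<delta>1 / (C + 1))"
        using y0 C by (intro mult_left_mono) (auto simp: \<delta>_def)
      also have "\<dots> = \<delta>1" using C by simp
      finally have "norm (F s (x s + (y s - x s)) - F s (x s) - D s (x s) (y s - x s))
          \<le> e / (C + 1) * norm (y s - x s)"
        by (intro rem s)
      also have "\<dots> \<le> e / (C + 1) * ((C + 1) * norm (y0 - x0))"
        using 1 2 e' by (intro mult_left_mono) auto
      also have "\<dots> = e * norm (y0 - x0)" using C by simp
      finally show "norm (F s (y s) - F s (x s) - D s (x s) (y s - x s)) \<le> e * norm (y0 - x0)"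
        by simp
    qed
  qed
qed

text \<open>
  No fixed point argument is needed for existence, because the solutions of the nonlinear equation are
  given: their difference quotients in the direction \<open>w\<close> are approximate solutions, by Gronwall's
  inequality they converge uniformly, and the limit is an exact solution.
\<close>

lemma variational_solution_exists:
  assumes x: "ivp_solution F a b x0 x"
    and ex: "\<And>k. \<exists>y. ivp_solution F a b k y"
  shows "\<exists>Y. variational_solution x w Y"
proof -
  obtain X where X: "\<And>k. ivp_solution F a b k (X k)" using ex by metis
  note xc = ivp_solution_continuous[OF x]
  obtain M where M: "0 \<le> M" "\<And>s v. s \<in> {a..b} \<Longrightarrow> norm (D s (x s) v) \<le> M * norm v"
    using D_along_bounded[OF xc] by blast
  obtain C where C: "0 \<le> C"
    and expan: "\<And>e. 0 < e \<Longrightarrow> \<exists>\<delta>>0. \<forall>y0 y. ivp_solution F a b y0 y \<longrightarrow> norm (y0 - x0) \<le> \<delta> \<longrightarrow>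
       (\<forall>s\<in>{a..b}. norm (y s - x s) \<le> C * norm (y0 - x0) \<and>
          norm (F s (y s) - F s (x s) - D s (x s) (y s - x s)) \<le> e * norm (y0 - x0))"
    using solution_expansion[OF x] by blast
  define \<epsilon> where "\<epsilon> n = inverse (real (Suc n))" for n
  have \<epsilon>: "0 < \<epsilon> n" for n by (simp add: \<epsilon>_def)
  define y where "y n = X (x0 + \<epsilon> n *\<^sub>R w)" for n
  define q where "q n s = inverse (\<epsilon> n) *\<^sub>R (y n s - x s)" for n s
  define q' where "q' n s = inverse (\<epsilon> n) *\<^sub>R (F s (y n s) - F s (x s))" for n s
  have yn: "ivp_solution F a b (x0 + \<epsilon> n *\<^sub>R w) (y n)" for n by (simp add: y_def X)
  have qd: "(q n has_vector_derivative q' n s) (at s within {a..b})" if "s \<in> {a..b}" for n s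
    unfolding q_def q'_def using yn[of n] x that unfolding ivp_solution_def
    by (intro bounded_linear.has_vector_derivative[OF bounded_linear_scaleR_right]
        has_vector_derivative_diff) auto
  have qc: "continuous_on {a..b} (q n)" for n
    using qd by (rule continuous_on_vector_derivative)
  have qa: "q n a = w" for n
    using ivp_solution_initial[OF yn[of n]] ivp_solution_initial[OF x] \<epsilon>[of n] by (simp add: q_def)
  \<comment> \<open>the difference quotients solve the variational equation up to a uniformly small error\<close>
  have defect: "\<exists>N. \<forall>n\<ge>N. \<forall>s\<in>{a..b}. norm (q' n s - D s (x s) (q n s)) \<le> e" if e: "0 < e" for e
  proof -
    have "0 < e / (norm w + 1)" using e by (simp add: add_nonneg_pos)
    then obtain \<delta> where \<delta>: "0 < \<delta>" and ex: "\<And>y0 y s. ivp_solution F a b y0 y \<Longrightarrow>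
        norm (y0 - x0) \<le> \<delta> \<Longrightarrow> s \<in> {a..b} \<Longrightarrow>
        norm (F s (y s) - F s (x s) - D s (x s) (y s - x s)) \<le> e / (norm w + 1) * norm (y0 - x0)"
      using expan by meson
    have "(\<lambda>n. \<epsilon> n * norm w) \<longlonglongrightarrow> 0 * norm w"
      unfolding \<epsilon>_def by (intro tendsto_mult LIMSEQ_inverse_real_of_nat tendsto_const)
    then have "\<forall>\<^sub>F n in sequentially. \<epsilon> n * norm w < \<delta>"
      using \<delta> by (intro order_tendstoD) auto
    then obtain N where N: "\<And>n. n \<ge> N \<Longrightarrow> \<epsilon> n * norm w < \<delta>"
      unfolding eventually_sequentially by blast
    have "norm (q' n s - D s (x s) (q n s)) \<le> e" if n: "n \<ge> N" and s: "s \<in> {a..b}" for n s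
    proof -
      have "q' n s - D s (x s) (q n s) =
          inverse (\<epsilon> n) *\<^sub>R (F s (y n s) - F s (x s) - D s (x s) (y n s - x s))"
        unfolding q_def q'_def blinfun.scaleR_right by (simp add: scaleR_diff_right)
      then have "norm (q' n s - D s (x s) (q n s)) =
          inverse (\<epsilon> n) * norm (F s (y n s) - F s (x s) - D s (x s) (y n s - x s))"
        using \<epsilon>[of n] by simp
      also have "\<dots> \<le> inverse (\<epsilon> n) * (e / (norm w + 1) * (\<epsilon> n * norm w))"
        using ex[OF yn[of n] _ s] N[OF n] \<epsilon>[of n] by (intro mult_left_mono) auto
      also have "\<dots> = e * (norm w / (norm w + 1))" using \<epsilon>[of n] by simp
      also have "\<dots> \<le> e * 1" using e by (intro mult_left_mono) (auto simp: divide_le_eq add_nonneg_pos)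
      finally show ?thesis by simp
    qed
    then show ?thesis by blast
  qed
  define B where "B = exp ((M + 1) * (b - a))"
  have B: "0 < B" by (simp add: B_def)
  have "uniformly_Cauchy_on {a..b} q"
  proof (rule uniformly_Cauchy_onI)
    fix e :: real assume e: "0 < e"
    define e' where "e' = e / (4 * B)"
    have e': "0 < e'" using e B by (simp add: e'_def)
    obtain N where N: "\<And>n s. n \<ge> N \<Longrightarrow> s \<in> {a..b} \<Longrightarrow> norm (q' n s - D s (x s) (q n s)) \<le> e'"
      using defect[OF e'] by blast
    have "dist (q m s) (q n s) < e" if m: "m \<ge> N" and n: "n \<ge> N" and s: "s \<in> {a..b}" for m n s
    proof -
      have "norm (q m s - q n s) \<le> exp ((M + 1) * (b - a)) * (norm (q m a - q n a) + 2 * e')"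
      proof (rule gronwall[where z' = "\<lambda>s. q' m s - q' n s", OF M(1) _ _ _ _ s])
        show "continuous_on {a..b} (\<lambda>s. q m s - q n s)" by (intro continuous_intros qc)
        fix r assume r: "a < r" "r < b"
        then have "(q m has_vector_derivative q' m r) (at r)" "(q n has_vector_derivative q' n r) (at r)"
          using qd[of r] by (simp_all add: at_within_Icc_at)
        then show "((\<lambda>s. q m s - q n s) has_vector_derivative q' m r - q' n r) (at r)"
          by (rule has_vector_derivative_diff)
        have rr: "r \<in> {a..b}" using r by simp
        have "q' m r - q' n r = (q' m r - D r (x r) (q m r)) - (q' n r - D r (x r) (q n r))
            + D r (x r) (q m r - q n r)"
          by (simp add: blinfun.diff_right)
        also have "norm \<dots> \<le> (e' + e') + M * norm (q m r - q n r)"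
          by (intro norm_triangle_le add_mono norm_triangle_le_diff N m n rr M(2))
        finally show "norm (q' m r - q' n r) \<le> M * norm (q m r - q n r) + 2 * e'" by simp
      qed (use e' in simp)
      also have "\<dots> = e / 2" using B by (simp add: qa e'_def flip: B_def)
      finally show ?thesis using e by (simp add: dist_norm)
    qed
    then show "\<exists>N. \<forall>s\<in>{a..b}. \<forall>m\<ge>N. \<forall>n\<ge>N. dist (q m s) (q n s) < e" by blast
  qed
  then obtain l where l: "uniform_limit {a..b} q l sequentially"
    using Cauchy_uniformly_convergent uniformly_convergent_on_def by blast
  have "\<exists>g. \<forall>s\<in>{a..b}. (\<lambda>n. q n s) \<longlonglongrightarrow> g s \<and>
      (g has_derivative (\<lambda>h. h *\<^sub>R D s (x s) (l s))) (at s within {a..b})"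
  proof (rule has_derivative_sequence[where f' = "\<lambda>n s h. h *\<^sub>R q' n s" and l = w])
    show "a \<in> {a..b}" using ab by simp
    show "(\<lambda>n. q n a) \<longlonglongrightarrow> w" by (simp add: qa)
    show "(q n has_derivative (\<lambda>h. h *\<^sub>R q' n s)) (at s within {a..b})" if "s \<in> {a..b}" for n s
      using qd[OF that] by (simp add: has_vector_derivative_def)
    fix e :: real assume e: "0 < e"
    obtain N where N: "\<And>n s. n \<ge> N \<Longrightarrow> s \<in> {a..b} \<Longrightarrow> norm (q' n s - D s (x s) (q n s)) \<le> e / 2"
      using defect[of "e / 2"] e by (metis half_gt_zero)
    have "0 < e / (2 * (M + 1))" using e M(1) by simp
    then have "\<forall>\<^sub>F n in sequentially. \<forall>s\<in>{a..b}. dist (q n s) (l s) < e / (2 * (M + 1))"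
      using l by (simp add: uniform_limit_iff)
    moreover have "\<forall>\<^sub>F n in sequentially. n \<ge> N" by (rule eventually_ge_at_top)
    ultimately show "\<forall>\<^sub>F n in sequentially. \<forall>s\<in>{a..b}. \<forall>h.
        norm (h *\<^sub>R q' n s - h *\<^sub>R D s (x s) (l s)) \<le> e * norm h"
    proof eventually_elim
      case (elim n)
      show ?case
      proof (intro ballI allI)
        fix s h assume s: "s \<in> {a..b}"
        have "q' n s - D s (x s) (l s) = (q' n s - D s (x s) (q n s)) + D s (x s) (q n s - l s)"
          by (simp add: blinfun.diff_right)
        also have "norm \<dots> \<le> e / 2 + M * norm (q n s - l s)"
          using elim s by (intro norm_triangle_le add_mono N M(2)) auto
        also have "M * norm (q n s - l s) \<le> (M + 1) * (e / (2 * (M + 1)))"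
          using elim s M(1) by (intro mult_mono) (auto simp: dist_norm less_imp_le)
        also have "\<dots> = e / 2"
        proof -
          have "c * (e / (2 * c)) = e / 2" if "0 < c" for c :: real using that by simp
          then show ?thesis using M(1) by (simp only: add_nonneg_pos zero_less_one)
        qed
        finally have "norm (q' n s - D s (x s) (l s)) \<le> e" by simp
        then have "\<bar>h\<bar> * norm (q' n s - D s (x s) (l s)) \<le> \<bar>h\<bar> * e"
          by (intro mult_left_mono) auto
        then show "norm (h *\<^sub>R q' n s - h *\<^sub>R D s (x s) (l s)) \<le> e * norm h"
          by (simp add: mult.commute flip: scaleR_diff_right)
      qed
    qed
  qed simp
  then obtain g where glim: "\<And>s. s \<in> {a..b} \<Longrightarrow> (\<lambda>n. q n s) \<longlonglongrightarrow> g s"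
    and gd: "\<And>s. s \<in> {a..b} \<Longrightarrow> (g has_vector_derivative D s (x s) (l s)) (at s within {a..b})"
    unfolding has_vector_derivative_def by blast
  have gl: "g s = l s" if "s \<in> {a..b}" for s
    using LIMSEQ_unique[OF glim[OF that] tendsto_uniform_limitI[OF l that]] .
  have "g a = w" using glim[of a] ab by (simp add: qa LIMSEQ_const_iff)
  then have "variational_solution x w g"
    unfolding variational_solution_def ivp_solution_def using gd gl by simp
  then show ?thesis by blast
qed

text \<open>Differentiability of the flow in the initial value, uniformly in time.\<close>

lemma solution_linearisation:
  assumes x: "ivp_solution F a b x0 x" and e: "0 < e"
  shows "\<exists>\<delta>>0. \<forall>y0 y Y. ivp_solution F a b y0 y \<longrightarrow> variational_solution x (y0 - x0) Y \<longrightarrow>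
     norm (y0 - x0) \<le> \<delta> \<longrightarrow> (\<forall>s\<in>{a..b}. norm (y s - x s - Y s) \<le> e * norm (y0 - x0))"
proof -
  note xc = ivp_solution_continuous[OF x]
  obtain M where M: "0 \<le> M" "\<And>s v. s \<in> {a..b} \<Longrightarrow> norm (D s (x s) v) \<le> M * norm v"
    using D_along_bounded[OF xc] by blast
  define B where "B = exp ((M + 1) * (b - a))"
  have B: "0 < B" by (simp add: B_def)
  have eB: "0 < e / B" using e B by simp
  obtain \<delta> where \<delta>: "0 < \<delta>" and expan: "\<And>y0 y s. ivp_solution F a b y0 y \<Longrightarrow>
      norm (y0 - x0) \<le> \<delta> \<Longrightarrow> s \<in> {a..b} \<Longrightarrow>
      norm (F s (y s) - F s (x s) - D s (x s) (y s - x s)) \<le> e / B * norm (y0 - x0)"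
    using solution_expansion[OF x] eB by metis
  show ?thesis
  proof (intro exI[of _ \<delta>] conjI allI impI ballI)
    show "0 < \<delta>" by (rule \<delta>)
    fix y0 y Y s
    assume y: "ivp_solution F a b y0 y" and Y: "variational_solution x (y0 - x0) Y"
      and y0: "norm (y0 - x0) \<le> \<delta>" and s: "s \<in> {a..b}"
    note Y = Y[unfolded variational_solution_def]
    have "norm (y s - x s - Y s) \<le> exp ((M + 1) * (b - a)) *
        (norm (y a - x a - Y a) + e / B * norm (y0 - x0))"
    proof (rule gronwall[where z' = "\<lambda>s. F s (y s) - F s (x s) - D s (x s) (Y s)", OF M(1) _ _ _ _ s])
      show "0 \<le> e / B * norm (y0 - x0)" by (intro mult_nonneg_nonneg less_imp_le[OF eB] norm_ge_zero)
      show "continuous_on {a..b} (\<lambda>s. y s - x s - Y s)"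
        by (intro continuous_intros xc ivp_solution_continuous[OF y] ivp_solution_continuous[OF Y])
      fix r assume r: "a < r" "r < b"
      show "((\<lambda>s. y s - x s - Y s) has_vector_derivative F r (y r) - F r (x r) - D r (x r) (Y r)) (at r)"
        by (intro has_vector_derivative_diff ivp_solution_derivative[OF x]
            ivp_solution_derivative[OF y] ivp_solution_derivative[OF Y] r)
      have "F r (y r) - F r (x r) - D r (x r) (Y r) =
          D r (x r) (y r - x r - Y r) + (F r (y r) - F r (x r) - D r (x r) (y r - x r))"
        by (simp add: blinfun.diff_right)
      also have "norm \<dots> \<le> M * norm (y r - x r - Y r) + e / B * norm (y0 - x0)"
        using r by (intro norm_triangle_le add_mono M(2) expan y y0) auto
      finally show "norm (F r (y r) - F r (x r) - D r (x r) (Y r))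
          \<le> M * norm (y r - x r - Y r) + e / B * norm (y0 - x0)" .
    qed
    also have "\<dots> = e * norm (y0 - x0)"
      using B ivp_solution_initial[OF x] ivp_solution_initial[OF y] ivp_solution_initial[OF Y]
      by (simp flip: B_def)
    finally show "norm (y s - x s - Y s) \<le> e * norm (y0 - x0)" .
  qed
qed

lemma composition_linearisation:
  fixes G :: "real \<Rightarrow> 'a \<Rightarrow> 'c::real_normed_vector"
  assumes DG_cont: "continuous_on ({a..b} \<times> UNIV) (\<lambda>(s, x). DG s x)"
    and G_deriv: "\<And>s x. s \<in> {a..b} \<Longrightarrow> (G s has_derivative blinfun_apply (DG s x)) (at x)"
    and x: "ivp_solution F a b x0 x" and e: "0 < e"
  shows "\<exists>\<delta>>0. \<forall>y0 y Y. ivp_solution F a b y0 y \<longrightarrow> variational_solution x (y0 - x0) Y \<longrightarrow>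
     norm (y0 - x0) \<le> \<delta> \<longrightarrow>
     (\<forall>s\<in>{a..b}. norm (G s (y s) - G s (x s) - DG s (x s) (Y s)) \<le> e * norm (y0 - x0))"
proof -
  note xc = ivp_solution_continuous[OF x]
  have "continuous_on {a..b} (\<lambda>s. DG s (x s))"
    by (rule continuous_on_along_path[OF DG_cont xc])
  then have "bounded ((\<lambda>s. DG s (x s)) ` {a..b})"
    by (intro compact_imp_bounded compact_continuous_image compact_Icc)
  then obtain M where M: "\<And>s. s \<in> {a..b} \<Longrightarrow> norm (DG s (x s)) \<le> M"
    unfolding bounded_iff by blast
  have M0: "0 \<le> M" by (rule order_trans[OF norm_ge_zero M[of a]]) (use ab in simp)
  have e1: "0 < e / (2 * (M + 1))" using e M0 by simp
  obtain \<delta>1 where \<delta>1: "0 < \<delta>1"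
    and lin: "\<And>y0 y Y s. ivp_solution F a b y0 y \<Longrightarrow> variational_solution x (y0 - x0) Y \<Longrightarrow>
      norm (y0 - x0) \<le> \<delta>1 \<Longrightarrow> s \<in> {a..b} \<Longrightarrow>
      norm (y s - x s - Y s) \<le> e / (2 * (M + 1)) * norm (y0 - x0)"
    using solution_linearisation[OF x e1] by metis
  obtain C \<delta>2 where C: "0 \<le> C" and \<delta>2: "0 < \<delta>2"
    and st: "\<And>y0 y s. ivp_solution F a b y0 y \<Longrightarrow> norm (y0 - x0) \<le> \<delta>2 \<Longrightarrow> s \<in> {a..b} \<Longrightarrow>
       norm (y s - x s) \<le> C * norm (y0 - x0)"
    using solution_stability[OF x] by metis
  have e2: "0 < e / (2 * (C + 1))" using e C by simp
  obtain \<delta>3 where \<delta>3: "0 < \<delta>3"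
    and rem: "\<And>s v. s \<in> {a..b} \<Longrightarrow> norm v \<le> \<delta>3 \<Longrightarrow>
       norm (G s (x s + v) - G s (x s) - DG s (x s) v) \<le> e / (2 * (C + 1)) * norm v"
    using uniform_remainder[OF DG_cont G_deriv xc e2] by blast
  define \<delta> where "\<delta> = min \<delta>1 (min \<delta>2 (\<delta>3 / (C + 1)))"
  show ?thesis
  proof (intro exI[of _ \<delta>] conjI allI impI ballI)
    show "0 < \<delta>" using \<delta>1 \<delta>2 \<delta>3 C by (simp add: \<delta>_def)
    fix y0 y Y s
    assume y: "ivp_solution F a b y0 y" and Y: "variational_solution x (y0 - x0) Y"
      and y0: "norm (y0 - x0) \<le> \<delta>" and s: "s \<in> {a..b}"
    have "norm (y s - x s) \<le> C * norm (y0 - x0)"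
      using st[OF y _ s] y0 by (simp add: \<delta>_def)
    also have "\<dots> \<le> (C + 1) * norm (y0 - x0)" by (simp add: mult_right_mono)
    finally have 1: "norm (y s - x s) \<le> (C + 1) * norm (y0 - x0)" .
    also have "\<dots> \<le> (C + 1) * (\<delta>3 / (C + 1))"
      using y0 C by (intro mult_left_mono) (auto simp: \<delta>_def)
    also have "\<dots> = \<delta>3" using C by simp
    finally have "norm (G s (x s + (y s - x s)) - G s (x s) - DG s (x s) (y s - x s))
        \<le> e / (2 * (C + 1)) * norm (y s - x s)"
      by (intro rem s)
    also have "\<dots> \<le> e / (2 * (C + 1)) * ((C + 1) * norm (y0 - x0))"
      using 1 e2 by (intro mult_left_mono) auto
    also have "\<dots> = e / 2 * norm (y0 - x0)"
    proof -
      have "e / (2 * c) * (c * n) = e / 2 * n" if "0 < c" for c n :: real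
        using that by simp
      then show ?thesis using C by (simp only: add_nonneg_pos zero_less_one)
    qed
    finally have 2: "norm (G s (y s) - G s (x s) - DG s (x s) (y s - x s)) \<le> e / 2 * norm (y0 - x0)"
      by simp
    have "norm (DG s (x s) (y s - x s - Y s)) \<le> norm (DG s (x s)) * norm (y s - x s - Y s)"
      by (rule norm_blinfun)
    also have "\<dots> \<le> (M + 1) * (e / (2 * (M + 1)) * norm (y0 - x0))"
      using M[OF s] M0 y0 by (intro mult_mono lin y Y s) (auto simp: \<delta>_def)
    also have "\<dots> = e / 2 * norm (y0 - x0)"
    proof -
      have "c * (e / (2 * c) * n) = e / 2 * n" if "0 < c" for c n :: real
        using that by simp
      then show ?thesis using M0 by (simp only: add_nonneg_pos zero_less_one)
    qed
    finally have 3: "norm (DG s (x s) (y s - x s - Y s)) \<le> e / 2 * norm (y0 - x0)" .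
    have "G s (y s) - G s (x s) - DG s (x s) (Y s) =
        (G s (y s) - G s (x s) - DG s (x s) (y s - x s)) + DG s (x s) (y s - x s - Y s)"
      by (simp add: blinfun.diff_right)
    also have "norm \<dots> \<le> e / 2 * norm (y0 - x0) + e / 2 * norm (y0 - x0)"
      by (intro norm_triangle_le add_mono 2 3)
    finally show "norm (G s (y s) - G s (x s) - DG s (x s) (Y s)) \<le> e * norm (y0 - x0)" by simp
  qed
qed

text \<open>
  Differentiation under the integral: the payoff accumulated along the solution that starts from \<open>k\<close>,
  plus a terminal payoff, as a function of \<open>k\<close>.
\<close>

theorem payoff_derivative:
  fixes G :: "real \<Rightarrow> 'a \<Rightarrow> real" and g :: "'a \<Rightarrow> real"
  assumes G_cont: "continuous_on ({a..b} \<times> UNIV) (\<lambda>(s, x). G s x)"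
    and DG_cont: "continuous_on ({a..b} \<times> UNIV) (\<lambda>(s, x). DG s x)"
    and G_deriv: "\<And>s x. s \<in> {a..b} \<Longrightarrow> (G s has_derivative blinfun_apply (DG s x)) (at x)"
    and Dg_cont: "continuous_on UNIV Dg"
    and g_deriv: "\<And>x. (g has_derivative blinfun_apply (Dg x)) (at x)"
    and p_cont: "continuous_on {a..b} p"
    and X: "\<And>k. ivp_solution F a b k (X k)"
    and x: "ivp_solution F a b x0 x"
    and Y: "\<And>w. variational_solution x w (Y w)"
  shows "(\<lambda>s. p s * DG s (x s) (Y w s)) integrable_on {a..b}"
    and "((\<lambda>k. integral {a..b} (\<lambda>s. p s * G s (X k s)) + q * g (X k b)) has_derivative
          (\<lambda>w. integral {a..b} (\<lambda>s. p s * DG s (x s) (Y w s)) + q * Dg (x b) (Y w b))) (at x0)"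
proof -
  note xc = ivp_solution_continuous[OF x]
  have Yc: "continuous_on {a..b} (Y w)" for w
    using Y[of w] unfolding variational_solution_def by (rule ivp_solution_continuous)
  have Gc: "continuous_on {a..b} (\<lambda>s. G s (y s))" if "continuous_on {a..b} y" for y
    by (rule continuous_on_along_path[OF G_cont that])
  have DGc: "continuous_on {a..b} (\<lambda>s. DG s (x s))"
    by (rule continuous_on_along_path[OF DG_cont xc])
  have intc: "continuous_on {a..b} (\<lambda>s. p s * DG s (x s) (Y w s))" for w
    by (intro continuous_intros p_cont DGc Yc)
  have inti: "(\<lambda>s. p s * DG s (x s) (Y w s)) integrable_on {a..b}" for w
    by (rule integrable_continuous_real[OF intc])
  then show "(\<lambda>s. p s * DG s (x s) (Y w s)) integrable_on {a..b}" .
  define L where "L w = integral {a..b} (\<lambda>s. p s * DG s (x s) (Y w s)) + q * Dg (x b) (Y w b)" for w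
  define E where "E k = integral {a..b} (\<lambda>s. p s * G s (X k s)) + q * g (X k b)" for k
  have Ylin: "Y (r *\<^sub>R v + t *\<^sub>R w) s = r *\<^sub>R Y v s + t *\<^sub>R Y w s" if "s \<in> {a..b}" for r t v w s
    using variational_solution_unique[OF xc variational_solution_linear[OF Y Y] Y that] by blast
  have Llin: "L (r *\<^sub>R v + t *\<^sub>R w) = r * L v + t * L w" for r t v w
  proof -
    have "integral {a..b} (\<lambda>s. p s * DG s (x s) (Y (r *\<^sub>R v + t *\<^sub>R w) s)) =
        integral {a..b} (\<lambda>s. r * (p s * DG s (x s) (Y v s)) + t * (p s * DG s (x s) (Y w s)))"
      by (rule integral_cong) (simp add: Ylin blinfun.add_right blinfun.scaleR_right algebra_simps)
    also have "\<dots> = r * integral {a..b} (\<lambda>s. p s * DG s (x s) (Y v s)) +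
        t * integral {a..b} (\<lambda>s. p s * DG s (x s) (Y w s))"
      by (subst integral_add) (auto intro!: integrable_on_mult_right inti)
    finally show ?thesis
      unfolding L_def using Ylin[of b] ab
      by (simp add: blinfun.add_right blinfun.scaleR_right algebra_simps)
  qed
  have "bounded_linear L"
  proof (subst linear_conv_bounded_linear[symmetric], rule linearI)
    show "L (v + w) = L v + L w" for v w using Llin[of 1 v 1 w] by simp
    show "L (r *\<^sub>R v) = r *\<^sub>R L v" for r v using Llin[of r v 0 v] by simp
  qed
  moreover have "\<exists>d>0. \<forall>k. norm (k - x0) < d \<longrightarrow> norm (E k - E x0 - L (k - x0)) \<le> e * norm (k - x0)"
    if e: "0 < e" for e
  proof -
    have "bounded (p ` {a..b})"
      by (intro compact_imp_bounded compact_continuous_image p_cont compact_Icc)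
    then obtain P where P: "\<And>s. s \<in> {a..b} \<Longrightarrow> norm (p s) \<le> P"
      unfolding bounded_iff by blast
    have P0: "0 \<le> P" using P[of a] ab by simp
    define Q where "Q = P * (b - a) + \<bar>q\<bar> + 1"
    have Q: "0 < Q" using P0 ab by (simp add: Q_def add_nonneg_pos)
    define e' where "e' = e / Q"
    have e': "0 < e'" using e Q by (simp add: e'_def)
    obtain \<delta>1 where \<delta>1: "0 < \<delta>1"
      and lin1: "\<And>y0 y Y s. ivp_solution F a b y0 y \<Longrightarrow> variational_solution x (y0 - x0) Y \<Longrightarrow>
        norm (y0 - x0) \<le> \<delta>1 \<Longrightarrow> s \<in> {a..b} \<Longrightarrow>
        norm (G s (y s) - G s (x s) - DG s (x s) (Y s)) \<le> e' * norm (y0 - x0)"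
      using composition_linearisation[OF DG_cont G_deriv x e'] by metis
    \<comment> \<open>the terminal payoff is treated as a running payoff that does not depend on time\<close>
    have Dg_cont': "continuous_on ({a..b} \<times> UNIV) (\<lambda>(s, x). Dg x)"
      using continuous_on_compose2[OF Dg_cont continuous_on_snd[OF continuous_on_id]]
      by (simp add: case_prod_unfold)
    obtain \<delta>2 where \<delta>2: "0 < \<delta>2"
      and lin2: "\<And>y0 y Y s. ivp_solution F a b y0 y \<Longrightarrow> variational_solution x (y0 - x0) Y \<Longrightarrow>
        norm (y0 - x0) \<le> \<delta>2 \<Longrightarrow> s \<in> {a..b} \<Longrightarrow>
        norm (g (y s) - g (x s) - Dg (x s) (Y s)) \<le> e' * norm (y0 - x0)"
      using composition_linearisation[OF Dg_cont' g_deriv x e'] by metis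
    show ?thesis
    proof (intro exI[of _ "min \<delta>1 \<delta>2"] conjI allI impI)
      show "0 < min \<delta>1 \<delta>2" using \<delta>1 \<delta>2 by simp
      fix k assume k: "norm (k - x0) < min \<delta>1 \<delta>2"
      have xX: "X x0 s = x s" if "s \<in> {a..b}" for s using solution_unique[OF x X that] .
      let ?R = "\<lambda>s. G s (X k s) - G s (x s) - DG s (x s) (Y (k - x0) s)"
      have Xc: "continuous_on {a..b} (X k)" by (rule ivp_solution_continuous[OF X])
      have i1: "(\<lambda>s. p s * G s (X k s)) integrable_on {a..b}"
        by (intro integrable_continuous_real continuous_intros p_cont Gc Xc)
      have i2: "(\<lambda>s. p s * G s (x s)) integrable_on {a..b}"
        by (intro integrable_continuous_real continuous_intros p_cont Gc xc)
      have "integral {a..b} (\<lambda>s. p s * ?R s) = integral {a..b} (\<lambda>s. p s * G s (X k s)) -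
          integral {a..b} (\<lambda>s. p s * G s (x s)) - integral {a..b} (\<lambda>s. p s * DG s (x s) (Y (k - x0) s))"
        using i1 i2 inti[of "k - x0"] by (simp add: right_diff_distrib integral_diff integrable_diff)
      moreover have "integral {a..b} (\<lambda>s. p s * G s (X x0 s)) = integral {a..b} (\<lambda>s. p s * G s (x s))"
        by (rule integral_cong) (simp add: xX)
      ultimately have "E k - E x0 - L (k - x0) = integral {a..b} (\<lambda>s. p s * ?R s) +
          q * (g (X k b) - g (x b) - Dg (x b) (Y (k - x0) b))"
        using xX[of b] ab by (simp add: E_def L_def algebra_simps)
      also have "norm \<dots> \<le> P * (e' * norm (k - x0)) * (b - a) + \<bar>q\<bar> * (e' * norm (k - x0))"
      proof (intro norm_triangle_le add_mono)
        show "norm (integral {a..b} (\<lambda>s. p s * ?R s)) \<le> P * (e' * norm (k - x0)) * (b - a)"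
        proof (rule integral_bound[OF ab])
          show "continuous_on {a..b} (\<lambda>s. p s * ?R s)"
            by (intro continuous_intros p_cont Gc Xc xc DGc Yc)
          fix s assume s: "s \<in> {a..b}"
          show "norm (p s * ?R s) \<le> P * (e' * norm (k - x0))"
            unfolding norm_mult using k P0 by (intro mult_mono P s lin1 X Y) auto
        qed
        have "norm (g (X k b) - g (x b) - Dg (x b) (Y (k - x0) b)) \<le> e' * norm (k - x0)"
          using k ab by (intro lin2 X Y) auto
        then show "norm (q * (g (X k b) - g (x b) - Dg (x b) (Y (k - x0) b)))
            \<le> \<bar>q\<bar> * (e' * norm (k - x0))"
          unfolding norm_mult by (intro mult_mono) auto
      qed
      also have "\<dots> = (Q - 1) * (e' * norm (k - x0))" by (simp add: Q_def algebra_simps)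
      also have "\<dots> \<le> Q * (e' * norm (k - x0))" using e' by (intro mult_right_mono) auto
      also have "\<dots> = e * norm (k - x0)" using Q by (simp add: e'_def)
      finally show "norm (E k - E x0 - L (k - x0)) \<le> e * norm (k - x0)" .
    qed
  qed
  ultimately have "(E has_derivative L) (at x0)"
    unfolding has_derivative_at_alt by blast
  then show "((\<lambda>k. integral {a..b} (\<lambda>s. p s * G s (X k s)) + q * g (X k b)) has_derivative
          (\<lambda>w. integral {a..b} (\<lambda>s. p s * DG s (x s) (Y w s)) + q * Dg (x b) (Y w b))) (at x0)"
    by (simp add: E_def[abs_def] L_def[abs_def])
qed

end

section \<open>Gradients, Jacobians and continuously differentiable functions\<close>

lemma gradient_inner:
  fixes F :: "'a::euclidean_space \<Rightarrow> real"
  assumes F: "(F has_derivative F') (at x)"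
  shows "gradient F x \<bullet> v = F' v"
proof -
  have lin: "linear F'" using F by (rule has_derivative_linear)
  have adj: "v \<bullet> adjoint F' 1 = F' v" for v
    using adjoint_works[OF lin, of v 1] by simp
  have "GDERIV F x :> adjoint F' 1"
    unfolding gderiv_def adj by (simp add: F)
  moreover have "D = adjoint F' 1" if "GDERIV F x :> D" for D
  proof -
    have "(\<lambda>h. h \<bullet> D) = F'"
      using that F unfolding gderiv_def by (rule has_derivative_unique)
    then have "h \<bullet> D = h \<bullet> adjoint F' 1" for h
      using adj[of h] by metis
    then show ?thesis using vector_eq_ldot by blast
  qed
  ultimately have "gradient F x = adjoint F' 1"
    unfolding gradient_def by (rule the_equality)
  then show ?thesis using adj[of v] by (simp add: inner_commute)
qed

lemma jacobian_mult:
  fixes F :: "real ^ 'n \<Rightarrow> real ^ 'm"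
  assumes F: "(F has_derivative F') (at x)"
  shows "jacobian F (at x) *v v = F' v"
proof -
  have "F differentiable (at x)" using F by (rule differentiableI)
  then have "(F has_derivative (\<lambda>h. jacobian F (at x) *v h)) (at x)"
    by (simp add: jacobian_works)
  from has_derivative_unique[OF this F] show ?thesis by metis
qed

text \<open>The bounded linear operator of a matrix.\<close>

definition matrix_blinfun :: "real ^ 'n ^ 'm \<Rightarrow> (real ^ 'n) \<Rightarrow>\<^sub>L (real ^ 'm)" where
  "matrix_blinfun A = Blinfun ((*v) A)"

lemma matrix_blinfun_apply: "blinfun_apply (matrix_blinfun A) = (*v) A"
  by (simp add: matrix_blinfun_def bounded_linear_Blinfun_apply matrix_vector_mul_bounded_linear)

lemma continuous_on_matrix_blinfun: "continuous_on S matrix_blinfun"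
proof (rule linear_continuous_on)
  have "linear (matrix_blinfun :: real ^ 'n ^ 'm \<Rightarrow> _)"
    by (rule linearI; rule blinfun_eqI)
       (simp_all add: matrix_blinfun_apply blinfun.add_left blinfun.scaleR_left
          matrix_vector_mult_add_rdistrib scaleR_matrix_vector_assoc)
  then show "bounded_linear (matrix_blinfun :: real ^ 'n ^ 'm \<Rightarrow> _)"
    by (simp add: linear_conv_bounded_linear)
qed

text \<open>The vector that represents a linear functional through the inner product.\<close>

definition riesz :: "('a::euclidean_space \<Rightarrow>\<^sub>L real) \<Rightarrow> 'a" where
  "riesz L = (\<Sum>b\<in>Basis. L b *\<^sub>R b)"

lemma bounded_linear_riesz: "bounded_linear riesz"
  unfolding riesz_def[abs_def]
  by (intro bounded_linear_sum bounded_linear_scaleR_left[THEN bounded_linear_compose] blinfun.bounded_linear_left)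

lemma gradient_riesz:
  assumes "(F has_derivative blinfun_apply L) (at x)"
  shows "gradient F x = riesz L"
  unfolding riesz_def gradient_inner[OF assms, symmetric] by (rule euclidean_representation[symmetric])

lemma C1_on_continuous: "C1_on S F \<Longrightarrow> continuous_on S F"
  unfolding C1_on_def by (meson has_derivative_continuous_on)

lemma C2_on_imp_C1_on: "C2_on S F \<Longrightarrow> C1_on S F"
  unfolding C2_on_def C1_on_def[of S F] by (meson C1_on_continuous)

lemma C1_on_cong:
  assumes F: "C1_on S F" and eq: "\<And>x. x \<in> S \<Longrightarrow> F x = G x"
  shows "C1_on S G"
proof -
  obtain F' where "\<And>x. x \<in> S \<Longrightarrow> (F has_derivative blinfun_apply (F' x)) (at x within S)"
    and "continuous_on S F'"
    using F unfolding C1_on_def by blast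
  then show ?thesis
    unfolding C1_on_def using has_derivative_transform[of _ S G F] eq by metis
qed

lemma bounded_linear_C1_on:
  assumes "bounded_linear F"
  shows "C1_on S F"
  unfolding C1_on_def
  by (rule exI[of _ "\<lambda>x. Blinfun F"])
     (simp add: assms bounded_linear_Blinfun_apply bounded_linear_imp_has_derivative)

lemma C1_on_compose:
  assumes F: "C1_on S F" and G: "C1_on UNIV G"
  shows "C1_on S (\<lambda>x. G (F x))"
proof -
  obtain F' where F': "\<And>x. x \<in> S \<Longrightarrow> (F has_derivative blinfun_apply (F' x)) (at x within S)"
    "continuous_on S F'"
    using F unfolding C1_on_def by blast
  obtain G' where G': "\<And>y. (G has_derivative blinfun_apply (G' y)) (at y)" "continuous_on UNIV G'"
    using G unfolding C1_on_def by auto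
  have "((\<lambda>x. G (F x)) has_derivative blinfun_apply (G' (F x) o\<^sub>L F' x)) (at x within S)" if "x \<in> S" for x
    using has_derivative_compose[OF F'(1)[OF that] G'(1)] by (simp add: blinfun_compose.rep_eq o_def)
  moreover have "continuous_on S (\<lambda>x. G' (F x) o\<^sub>L F' x)"
    by (intro bounded_bilinear.continuous_on[OF bounded_bilinear_blinfun_compose] F'(2)
        continuous_on_compose2[OF G'(2) C1_on_continuous[OF F]]) simp
  ultimately show ?thesis
    unfolding C1_on_def by (intro exI[of _ "\<lambda>x. G' (F x) o\<^sub>L F' x"]) simp
qed

text \<open>
  Composing the derivative of a function of \<open>(t, k)\<close> with the embedding \<open>v \<mapsto> (0, v)\<close> gives its
  partial derivative in \<open>k\<close>.
\<close>

definition space_embedding :: "'a::real_normed_vector \<Rightarrow>\<^sub>L (real \<times> 'a)" where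
  "space_embedding = Blinfun (Pair 0)"

lemma space_embedding_apply: "blinfun_apply space_embedding v = (0, v)"
  unfolding space_embedding_def
  by (subst bounded_linear_Blinfun_apply) (auto intro: bounded_linear_Pair bounded_linear_zero bounded_linear_ident)

lemma partial_derivative:
  fixes \<phi> :: "real \<Rightarrow> 'a::real_normed_vector \<Rightarrow> 'b::real_normed_vector"
  assumes F': "((\<lambda>(t, k). \<phi> t k) has_derivative blinfun_apply F') (at (t, k) within I \<times> UNIV)"
    and t: "t \<in> I"
  shows "(\<phi> t has_derivative blinfun_apply (F' o\<^sub>L space_embedding)) (at k)"
proof -
  have "((\<lambda>k. (t, k)) has_derivative (\<lambda>v. (0, v))) (at k)"
    by (intro derivative_intros)
  moreover have "((\<lambda>(t, k). \<phi> t k) has_derivative blinfun_apply F') (at (t, k) within (\<lambda>k. (t, k)) ` UNIV)"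
    by (rule has_derivative_subset[OF F']) (use t in auto)
  ultimately have "((\<lambda>k. (\<lambda>(t, k). \<phi> t k) (t, k)) has_derivative (\<lambda>v. F' (0, v))) (at k)"
    by (rule has_derivative_in_compose)
  then show ?thesis by (simp add: blinfun_compose.rep_eq o_def space_embedding_apply)
qed

lemma C1_on_partial:
  fixes \<phi> :: "real \<Rightarrow> 'a::real_normed_vector \<Rightarrow> 'b::real_normed_vector"
  assumes "C1_on (I \<times> UNIV) (\<lambda>(t, k). \<phi> t k)"
  obtains D where "continuous_on (I \<times> UNIV) (\<lambda>(t, k). D t k)"
    "\<And>t k. t \<in> I \<Longrightarrow> (\<phi> t has_derivative blinfun_apply (D t k)) (at k)"
proof -
  obtain F' where F': "\<And>p. p \<in> I \<times> UNIV \<Longrightarrow>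
      ((\<lambda>(t, k). \<phi> t k) has_derivative blinfun_apply (F' p)) (at p within I \<times> UNIV)"
    "continuous_on (I \<times> UNIV) F'"
    using assms unfolding C1_on_def by blast
  show thesis
  proof (rule that[of "\<lambda>t k. F' (t, k) o\<^sub>L space_embedding"])
    show "continuous_on (I \<times> UNIV) (\<lambda>(t, k). F' (t, k) o\<^sub>L space_embedding)"
      unfolding case_prod_unfold prod.collapse
      by (intro bounded_bilinear.continuous_on[OF bounded_bilinear_blinfun_compose] F'(2)
          continuous_on_const)
    show "(\<phi> t has_derivative blinfun_apply (F' (t, k) o\<^sub>L space_embedding)) (at k)" if "t \<in> I" for t k
      using that by (intro partial_derivative[of \<phi> _ t k I] F') auto
  qed
qed

lemma C1_on_gradient:
  fixes V :: "real \<Rightarrow> 'a::euclidean_space \<Rightarrow> real"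
  assumes "C2_on (I \<times> UNIV) (\<lambda>(t, k). V t k)"
  shows "C1_on (I \<times> UNIV) (\<lambda>(t, k). gradient (V t) k)"
proof -
  obtain V' where V': "\<And>p. p \<in> I \<times> UNIV \<Longrightarrow>
      ((\<lambda>(t, k). V t k) has_derivative blinfun_apply (V' p)) (at p within I \<times> UNIV)"
    and C1: "C1_on (I \<times> UNIV) V'"
    using assms unfolding C2_on_def by blast
  have "bounded_linear (\<lambda>L. riesz (L o\<^sub>L space_embedding))"
    by (rule bounded_linear_compose[OF bounded_linear_riesz
          bounded_bilinear.bounded_linear_left[OF bounded_bilinear_blinfun_compose]])
  then have "C1_on (I \<times> UNIV) (\<lambda>p. riesz (V' p o\<^sub>L space_embedding))"
    by (intro C1_on_compose[OF C1] bounded_linear_C1_on)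
  then show ?thesis
  proof (rule C1_on_cong)
    fix p :: "real \<times> 'a" assume p: "p \<in> I \<times> UNIV"
    obtain t k where tk: "p = (t, k)" by (cases p)
    have "(V t has_derivative blinfun_apply (V' p o\<^sub>L space_embedding)) (at k)"
      using V'[OF p] p unfolding tk by (intro partial_derivative[of V _ t k I]) auto
    from gradient_riesz[OF this]
    show "riesz (V' p o\<^sub>L space_embedding) = (\<lambda>(t, k). gradient (V t) k) p"
      by (simp add: tk)
  qed
qed

text \<open>
  The weak inequality holds because the chord from \<open>x\<close> to \<open>z\<close> lies below the graph. It is then
  applied at the midpoint of \<open>x\<close> and \<open>y\<close>, where the graph lies strictly above the chord.
\<close>

lemma strictly_concave_below_tangent:
  fixes u :: "'a::real_normed_vector \<Rightarrow> real"
  assumes u: "strictly_concave u" and u': "(u has_derivative u') (at x)" and ne: "y \<noteq> x"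
  shows "u y < u x + u' (y - x)"
proof -
  interpret u': bounded_linear u' by (rule has_derivative_bounded_linear[OF u'])
  \<comment> \<open>otherwise the graph would fall below the chord just after leaving \<open>x\<close>\<close>
  have tangent: "u z \<le> u x + u' (z - x)" if z: "z \<noteq> x" for z
  proof (rule ccontr)
    assume "\<not> u z \<le> u x + u' (z - x)"
    define \<psi> where "\<psi> \<theta> = u (x + \<theta> *\<^sub>R (z - x)) - \<theta> * (u z - u x)" for \<theta>
    have "((\<lambda>\<theta>. x + \<theta> *\<^sub>R (z - x)) has_derivative (\<lambda>\<theta>. \<theta> *\<^sub>R (z - x))) (at (0::real))"
      by (auto intro!: derivative_eq_intros)
    from has_derivative_compose[OF this, of u u'] u'
    have "((\<lambda>\<theta>. u (x + \<theta> *\<^sub>R (z - x))) has_real_derivative u' (z - x)) (at 0)"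
      by (auto simp: has_field_derivative_def u'.scaleR mult.commute[of _ "u' (z - x)"])
    then have "(\<psi> has_real_derivative u' (z - x) - (u z - u x)) (at 0)"
      unfolding \<psi>_def by (auto intro!: derivative_eq_intros)
    then obtain d where d: "0 < d" "\<And>\<theta>. 0 < \<theta> \<Longrightarrow> \<theta> < d \<Longrightarrow> \<psi> \<theta> < \<psi> 0"
      using DERIV_neg_dec_right[of \<psi> _ 0] \<open>\<not> u z \<le> u x + u' (z - x)\<close> by force
    define \<theta> where "\<theta> = min (d / 2) (1 / 2)"
    have \<theta>: "0 < \<theta>" "\<theta> < d" "\<theta> < 1" using d by (auto simp: \<theta>_def)
    have "(1 - \<theta>) * u x + \<theta> * u z < u ((1 - \<theta>) *\<^sub>R x + \<theta> *\<^sub>R z)"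
      using z \<theta> by (intro u[unfolded strictly_concave_def, rule_format]) auto
    also have "(1 - \<theta>) *\<^sub>R x + \<theta> *\<^sub>R z = x + \<theta> *\<^sub>R (z - x)" by (simp add: algebra_simps)
    finally have "\<psi> 0 < \<psi> \<theta>" by (simp add: \<psi>_def algebra_simps)
    then show False using d(2)[OF \<theta>(1,2)] by simp
  qed
  define m where "m = (1 - 1/2) *\<^sub>R x + (1/2) *\<^sub>R y"
  have mx: "m - x = (1/2) *\<^sub>R (y - x)"
    by (simp add: m_def algebra_simps flip: scaleR_add_left)
  have "(1 - 1/2) * u x + 1/2 * u y < u m"
    unfolding m_def using ne by (intro u[unfolded strictly_concave_def, rule_format]) auto
  also have "u m \<le> u x + u' (m - x)" using mx ne by (intro tangent) auto
  also have "\<dots> = u x + 1/2 * u' (y - x)" unfolding mx u'.scaleR by simp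
  finally show ?thesis by simp
qed

section \<open>Equilibrium strategies and the value function\<close>

text \<open>
  A strategy \<open>\<sigma>\<close> with jointly continuous derivative \<open>D\<sigma>\<close> in the capital and a flow \<open>K\<close>, together
  with the regularity of the data that differentiating the value function requires. The derivative is
  an operator and not a matrix, so that \<open>\<sigma>\<close> may be given either through its Jacobian or as a
  composition of continuously differentiable functions.
\<close>

locale strategy_flow =
  fixes T :: real and h :: "real \<Rightarrow> real" and u g :: "real ^ 'd \<Rightarrow> real"
    and f \<sigma> :: "real \<Rightarrow> real ^ 'd \<Rightarrow> real ^ 'd"
    and D\<sigma> :: "real \<Rightarrow> real ^ 'd \<Rightarrow> (real ^ 'd) \<Rightarrow>\<^sub>L (real ^ 'd)"
    and K :: "real \<Rightarrow> real \<Rightarrow> real ^ 'd \<Rightarrow> real ^ 'd"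
  assumes h_cont: "continuous_on {0..} h"
    and u_C1: "C1_on UNIV u" and g_C1: "C1_on UNIV g"
    and f_C1: "C1_on ({0..T} \<times> UNIV) (\<lambda>(t, k). f t k)"
    and \<sigma>_cont: "continuous_on ({0..T} \<times> UNIV) (\<lambda>(t, k). \<sigma> t k)"
    and D\<sigma>_cont: "continuous_on ({0..T} \<times> UNIV) (\<lambda>(t, k). D\<sigma> t k)"
    and \<sigma>_deriv: "\<And>t k. t \<in> {0..T} \<Longrightarrow> (\<sigma> t has_derivative blinfun_apply (D\<sigma> t k)) (at k)"
    and flow: "is_flow T f \<sigma> K"
begin

abbreviation V :: "real \<Rightarrow> real ^ 'd \<Rightarrow> real" where
  "V \<equiv> value_function T h u g \<sigma> K"

lemma drift_C1_field:
  assumes t: "t \<in> {0..T}"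
  obtains D where "C1_field t T (\<lambda>s x. f s x - \<sigma> s x) D"
    "\<And>s x v. s \<in> {t..T} \<Longrightarrow> D s x v = (jacobian (f s) (at x) - jacobian (\<sigma> s) (at x)) *v v"
proof -
  obtain Df where Df_cont: "continuous_on ({0..T} \<times> UNIV) (\<lambda>(t, k). Df t k)"
    and f_deriv: "\<And>t k. t \<in> {0..T} \<Longrightarrow> (f t has_derivative blinfun_apply (Df t k)) (at k)"
    using C1_on_partial[OF f_C1] by blast
  have sub: "{t..T} \<times> UNIV \<subseteq> {0..T} \<times> (UNIV :: (real ^ 'd) set)" using t by auto
  show thesis
  proof (rule that[of "\<lambda>s x. Df s x - D\<sigma> s x"])
    show "C1_field t T (\<lambda>s x. f s x - \<sigma> s x) (\<lambda>s x. Df s x - D\<sigma> s x)"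
    proof
      show "t \<le> T" using t by simp
      show "continuous_on ({t..T} \<times> UNIV) (\<lambda>(s, x). Df s x - D\<sigma> s x)"
        using continuous_on_diff[OF continuous_on_subset[OF Df_cont sub] continuous_on_subset[OF D\<sigma>_cont sub]]
        by (simp add: case_prod_unfold)
      show "((\<lambda>x. f s x - \<sigma> s x) has_derivative blinfun_apply (Df s x - D\<sigma> s x)) (at x)"
        if "s \<in> {t..T}" for s x
        using has_derivative_diff[OF f_deriv[of s x] \<sigma>_deriv[of s x]] that t
        by (simp add: minus_blinfun.rep_eq)
    qed
    show "(Df s x - D\<sigma> s x) v = (jacobian (f s) (at x) - jacobian (\<sigma> s) (at x)) *v v"
      if "s \<in> {t..T}" for s x v
      using jacobian_mult[OF f_deriv[of s x]] jacobian_mult[OF \<sigma>_deriv[of s x]] that t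
      by (simp add: matrix_vector_mult_diff_rdistrib blinfun.diff_left)
  qed
qed

lemma state_path_flow: "t \<in> {0..T} \<Longrightarrow> state_path T f \<sigma> t k (\<lambda>s. K s t k)"
  using flow by (simp add: is_flow_def)

lemma state_path_unique:
  assumes t: "t \<in> {0..T}" and k0: "state_path T f \<sigma> t k k0" and s: "s \<in> {t..T}"
  shows "K s t k = k0 s"
proof -
  obtain D where "C1_field t T (\<lambda>s x. f s x - \<sigma> s x) D"
    by (rule drift_C1_field[OF t])
  from C1_field.solution_unique[OF this k0[unfolded state_path_def]
      state_path_flow[OF t, unfolded state_path_def] s]
  show ?thesis .
qed

lemma value_along_path:
  assumes t: "t \<in> {0..T}" and k0: "state_path T f \<sigma> t k k0"
  shows "(\<lambda>s. h (s - t) * u (\<sigma> s (k0 s))) integrable_on {t..T}"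
    and "V t k = integral {t..T} (\<lambda>s. h (s - t) * u (\<sigma> s (k0 s))) + h (T - t) * g (k0 T)"
proof -
  have k0c: "continuous_on {t..T} k0"
    using k0 unfolding state_path_def by (rule ivp_solution_continuous)
  have "continuous_on ({t..T} \<times> UNIV) (\<lambda>(s, x). \<sigma> s x)"
    by (rule continuous_on_subset[OF \<sigma>_cont]) (use t in auto)
  from continuous_on_along_path[OF this k0c]
  show "(\<lambda>s. h (s - t) * u (\<sigma> s (k0 s))) integrable_on {t..T}"
    by (intro integrable_continuous_real continuous_on_mult
        continuous_on_compose2[OF h_cont] continuous_on_compose2[OF C1_on_continuous[OF u_C1]]
        continuous_intros) auto
  have "integral {t..T} (\<lambda>s. h (s - t) * u (\<sigma> s (K s t k))) =
      integral {t..T} (\<lambda>s. h (s - t) * u (\<sigma> s (k0 s)))"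
    by (rule integral_cong) (simp add: state_path_unique[OF t k0])
  then show "V t k = integral {t..T} (\<lambda>s. h (s - t) * u (\<sigma> s (k0 s))) + h (T - t) * g (k0 T)"
    using t by (simp add: value_function_def state_path_unique[OF t k0])
qed

lemma linearised_path_exists:
  assumes t: "t \<in> {0..T}" and k0: "state_path T f \<sigma> t k k0"
  shows "\<exists>k1. linearised_path T f \<sigma> t k c k0 k1"
proof -
  obtain D where D: "C1_field t T (\<lambda>s x. f s x - \<sigma> s x) D"
    and DJ: "\<And>s x v. s \<in> {t..T} \<Longrightarrow> D s x v = (jacobian (f s) (at x) - jacobian (\<sigma> s) (at x)) *v v"
    using drift_C1_field[OF t] by blast
  interpret C1_field t T "\<lambda>s x. f s x - \<sigma> s x" D by (rule D)
  have "\<exists>Y. variational_solution k0 (\<sigma> t k - c) Y"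
    using variational_solution_exists k0 state_path_flow[OF t] unfolding state_path_def by blast
  then show ?thesis
    unfolding variational_solution_def linearised_path_def
    using ivp_solution_cong[of t T "\<lambda>s v. D s (k0 s) v" _
        "\<lambda>s v. (jacobian (f s) (at (k0 s)) - jacobian (\<sigma> s) (at (k0 s))) *v v"] DJ by blast
qed

text \<open>
  The last two terms of \<open>P\<^sub>1\<close> are the derivative of the value function in the direction
  \<open>\<sigma>(t,k) - c\<close>, which is the initial value of \<open>k1 c\<close>.
\<close>

theorem value_function_derivative:
  assumes t: "t \<in> {0..T}" and k0: "state_path T f \<sigma> t k k0"
    and k1: "\<And>c. linearised_path T f \<sigma> t k c k0 (k1 c)"
  shows "P1_integrand h u \<sigma> t k0 (k1 c) integrable_on {t..T}"
    and "V t differentiable (at k)"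
    and "P1 T h u g \<sigma> k0 (k1 c) t k c = u c - u (\<sigma> t k) - gradient (V t) k \<bullet> (c - \<sigma> t k)"
proof -
  obtain D where D: "C1_field t T (\<lambda>s x. f s x - \<sigma> s x) D"
    and DJ: "\<And>s x v. s \<in> {t..T} \<Longrightarrow> D s x v = (jacobian (f s) (at x) - jacobian (\<sigma> s) (at x)) *v v"
    using drift_C1_field[OF t] by blast
  interpret C1_field t T "\<lambda>s x. f s x - \<sigma> s x" D by (rule D)
  \<comment> \<open>reindexed by the initial value: \<open>k1 c\<close> starts from \<open>\<sigma> t k - c\<close>\<close>
  define Y where "Y w = k1 (\<sigma> t k - w)" for w
  have Y: "variational_solution k0 w (Y w)" for w
    using k1[of "\<sigma> t k - w"] unfolding variational_solution_def linearised_path_def Y_def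
    using ivp_solution_cong[of t T "\<lambda>s v. D s (k0 s) v" "k1 (\<sigma> t k - w)"
        "\<lambda>s v. (jacobian (f s) (at (k0 s)) - jacobian (\<sigma> s) (at (k0 s))) *v v"] DJ by simp
  obtain U where U: "\<And>x. (u has_derivative blinfun_apply (U x)) (at x)" "continuous_on UNIV U"
    using u_C1 unfolding C1_on_def by auto
  obtain Dg where Dg: "\<And>x. (g has_derivative blinfun_apply (Dg x)) (at x)" "continuous_on UNIV Dg"
    using g_C1 unfolding C1_on_def by auto
  have sub: "{t..T} \<times> UNIV \<subseteq> {0..T} \<times> (UNIV :: (real ^ 'd) set)" using t by auto
  note \<sigma>c = continuous_on_subset[OF \<sigma>_cont sub] and D\<sigma>c = continuous_on_subset[OF D\<sigma>_cont sub]
  have Gc: "continuous_on ({t..T} \<times> UNIV) (\<lambda>(s, x). u (\<sigma> s x))"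
    using continuous_on_compose2[OF C1_on_continuous[OF u_C1] \<sigma>c] by (simp add: case_prod_unfold)
  have "continuous_on ({t..T} \<times> UNIV) (\<lambda>p. U (\<sigma> (fst p) (snd p)) o\<^sub>L D\<sigma> (fst p) (snd p))"
    using D\<sigma>c continuous_on_compose2[OF U(2) \<sigma>c]
    by (intro bounded_bilinear.continuous_on[OF bounded_bilinear_blinfun_compose])
       (simp_all add: case_prod_unfold)
  then have DGc: "continuous_on ({t..T} \<times> UNIV) (\<lambda>(s, x). U (\<sigma> s x) o\<^sub>L D\<sigma> s x)"
    by (simp add: case_prod_unfold)
  have Gd: "((\<lambda>x. u (\<sigma> s x)) has_derivative blinfun_apply (U (\<sigma> s x) o\<^sub>L D\<sigma> s x)) (at x)"
    if "s \<in> {t..T}" for s x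
    using has_derivative_compose[OF \<sigma>_deriv[of s x] U(1)] that t by (simp add: blinfun_compose.rep_eq o_def)
  have pc: "continuous_on {t..T} (\<lambda>s. h (s - t))"
    by (intro continuous_on_compose2[OF h_cont] continuous_intros) auto
  have X: "ivp_solution (\<lambda>s x. f s x - \<sigma> s x) t T k (\<lambda>s. K s t k)" for k
    using state_path_flow[OF t] unfolding state_path_def .
  note payoff = payoff_derivative[OF Gc DGc Gd Dg(2,1) pc X k0[unfolded state_path_def] Y]
  have integrand: "P1_integrand h u \<sigma> t k0 y s = h (s - t) * (U (\<sigma> s (k0 s)) o\<^sub>L D\<sigma> s (k0 s)) (y s)"
    if "s \<in> {t..T}" for y s
  proof -
    have "jacobian (\<sigma> s) (at (k0 s)) *v y s = D\<sigma> s (k0 s) (y s)"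
      using that t by (intro jacobian_mult \<sigma>_deriv) auto
    then show ?thesis
      by (simp add: P1_integrand_def dot_lmul_matrix gradient_inner[OF U(1)])
  qed
  have k1Y: "k1 c = Y (\<sigma> t k - c)" for c by (simp add: Y_def)
  show "P1_integrand h u \<sigma> t k0 (k1 c) integrable_on {t..T}"
    unfolding k1Y by (rule integrable_eq[OF payoff(1)[of "\<sigma> t k - c"]]) (assumption | rule integrand[symmetric])+
  define L where "L w = integral {t..T} (\<lambda>s. h (s - t) * (U (\<sigma> s (k0 s)) o\<^sub>L D\<sigma> s (k0 s)) (Y w s)) +
      h (T - t) * Dg (k0 T) (Y w T)" for w
  have VL: "(V t has_derivative L) (at k)"
    unfolding value_function_def[abs_def] L_def[abs_def] by (rule payoff(2))
  then show "V t differentiable (at k)" by (rule differentiableI)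
  have "integral {t..T} (P1_integrand h u \<sigma> t k0 (k1 c)) =
      integral {t..T} (\<lambda>s. h (s - t) * (U (\<sigma> s (k0 s)) o\<^sub>L D\<sigma> s (k0 s)) (k1 c s))"
    by (rule integral_cong) (rule integrand)
  then have "P1 T h u g \<sigma> k0 (k1 c) t k c = u c - u (\<sigma> t k) + L (\<sigma> t k - c)"
    unfolding P1_def L_def k1Y by (simp add: gradient_inner[OF Dg(1)])
  also have "L (\<sigma> t k - c) = gradient (V t) k \<bullet> (\<sigma> t k - c)"
    by (simp add: gradient_inner[OF VL])
  finally show "P1 T h u g \<sigma> k0 (k1 c) t k c = u c - u (\<sigma> t k) - gradient (V t) k \<bullet> (c - \<sigma> t k)"
    by (simp add: inner_diff_right)
qed

lemma value_function_differentiable: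
  assumes t: "t \<in> {0..T}"
  shows "V t differentiable (at k)"
proof -
  obtain k1 where "\<And>c. linearised_path T f \<sigma> t k c (\<lambda>s. K s t k) (k1 c)"
    using linearised_path_exists[OF t state_path_flow[OF t]] by metis
  then show ?thesis by (rule value_function_derivative(2)[OF t state_path_flow[OF t]])
qed

text \<open>The first order condition of an equilibrium, and its sufficiency when \<open>u\<close> is strictly concave.\<close>

lemma equilibrium_first_order:
  assumes eq: "equilibrium_strategy T h u f g \<sigma>" and t: "t \<in> {0..T}"
  shows "gradient u (\<sigma> t k) = gradient (V t) k"
proof -
  let ?k0 = "\<lambda>s. K s t k"
  note k0 = state_path_flow[OF t, of k]
  obtain k1 where k1: "\<And>c. linearised_path T f \<sigma> t k c ?k0 (k1 c)"
    using linearised_path_exists[OF t k0] by metis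
  have "is_arg_max (\<lambda>c. P1 T h u g \<sigma> ?k0 (k1 c) t k c) (\<lambda>_. True) (\<sigma> t k)"
    using eq t k0 k1 unfolding equilibrium_strategy_def by blast
  then have max: "u c - gradient (V t) k \<bullet> c \<le> u (\<sigma> t k) - gradient (V t) k \<bullet> \<sigma> t k" for c
    unfolding is_arg_max_linorder value_function_derivative(3)[OF t k0 k1]
    by (simp add: inner_diff_right algebra_simps)
  obtain u' where u': "(u has_derivative u') (at (\<sigma> t k))"
    using u_C1 unfolding C1_on_def by auto
  have "((\<lambda>c. u c - gradient (V t) k \<bullet> c) has_derivative (\<lambda>v. u' v - gradient (V t) k \<bullet> v)) (at (\<sigma> t k))"
    by (intro derivative_intros u')
  then have "(\<lambda>v. u' v - gradient (V t) k \<bullet> v) = (\<lambda>v. 0)"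
    by (rule has_derivative_local_max) (simp add: max)
  then have "gradient u (\<sigma> t k) \<bullet> v = gradient (V t) k \<bullet> v" for v
    unfolding gradient_inner[OF u'] by (metis eq_iff_diff_eq_0)
  then show ?thesis using vector_eq_rdot by blast
qed

lemma equilibrium_if_first_order:
  assumes concave: "strictly_concave u"
    and foc: "\<And>t k. t \<in> {0..T} \<Longrightarrow> gradient u (\<sigma> t k) = gradient (V t) k"
  shows "equilibrium_strategy T h u f g \<sigma>"
  unfolding equilibrium_strategy_def
proof (intro conjI ballI allI impI)
  fix t k assume t: "t \<in> {0..T}"
  show "\<sigma> t differentiable (at k)" using \<sigma>_deriv[OF t] by (rule differentiableI)
  show "\<exists>k0. state_path T f \<sigma> t k k0" using state_path_flow[OF t] by blast
  fix k0 assume k0: "state_path T f \<sigma> t k k0"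
  show "\<exists>k1. linearised_path T f \<sigma> t k c k0 k1" for c by (rule linearised_path_exists[OF t k0])
  fix k1 assume "\<forall>c. linearised_path T f \<sigma> t k c k0 (k1 c)"
  then have k1: "\<And>c. linearised_path T f \<sigma> t k c k0 (k1 c)" by blast
  show "P1_integrand h u \<sigma> t k0 (k1 c) integrable_on {t..T}" for c
    by (rule value_function_derivative(1)[OF t k0 k1])
  obtain u' where u': "(u has_derivative u') (at (\<sigma> t k))"
    using u_C1 unfolding C1_on_def by auto
  let ?P = "\<lambda>c. P1 T h u g \<sigma> k0 (k1 c) t k c"
  have P: "?P c = u c - u (\<sigma> t k) - u' (c - \<sigma> t k)" for c
    unfolding value_function_derivative(3)[OF t k0 k1]
    by (simp add: foc[OF t, symmetric] gradient_inner[OF u'])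
  have "?P (\<sigma> t k) = 0"
    unfolding value_function_derivative(3)[OF t k0 k1] by simp
  moreover have "?P c < 0" if "c \<noteq> \<sigma> t k" for c
    using strictly_concave_below_tangent[OF concave u' that] unfolding P by simp
  ultimately show "is_arg_max ?P (\<lambda>_. True) c \<longleftrightarrow> c = \<sigma> t k" for c
    unfolding is_arg_max_linorder by (metis less_eq_real_def not_less)
qed

end

theorem theorem2:
  fixes T :: real
    and h h' :: "real \<Rightarrow> real"
    and u :: "real ^ 'd \<Rightarrow> real"
    and f :: "real \<Rightarrow> real ^ 'd \<Rightarrow> real ^ 'd"
    and g :: "real ^ 'd \<Rightarrow> real"
    and i :: "real ^ 'd \<Rightarrow> real ^ 'd"
  assumes T_pos: "0 < T"
    and h_deriv: "\<And>t. 0 \<le> t \<Longrightarrow> (h has_real_derivative h' t) (at t within {0..})"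
    and h'_cont: "continuous_on {0..} h'"
    and h_0: "h 0 = 1"
    and h_nonneg: "\<And>t. 0 \<le> t \<Longrightarrow> 0 \<le> h t"
    and h'_nonpos: "\<And>t. 0 \<le> t \<Longrightarrow> h' t \<le> 0"
    and h_lim: "(h \<longlongrightarrow> 0) at_top"
    and u_C2: "C2_on UNIV u"
    and f_C2: "C2_on ({0..T} \<times> UNIV) (\<lambda>(t, k). f t k)"
    and g_C2: "C2_on UNIV g"
    and u_concave: "strictly_concave u"
    and f_concave: "\<And>t j. t \<in> {0..T} \<Longrightarrow> strictly_concave (\<lambda>k. f t k $ j)"
    and i_inverse: "\<And>c x. gradient u c = x \<longleftrightarrow> c = i x"
    and i_C1: "C1_on UNIV i"
  shows "(\<forall>\<sigma> K.
            continuous_on ({0..T} \<times> UNIV) (\<lambda>(t, k). \<sigma> t k) \<longrightarrow>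
            (\<forall>t\<in>{0..T}. \<forall>k. \<sigma> t differentiable (at k)) \<longrightarrow>
            continuous_on ({0..T} \<times> UNIV) (\<lambda>(t, k). jacobian (\<sigma> t) (at k)) \<longrightarrow>
            is_flow T f \<sigma> K \<longrightarrow>
            equilibrium_strategy T h u f g \<sigma> \<longrightarrow>
            satisfies_IE T h u f g i (value_function T h u g \<sigma> K) \<and>
            (\<forall>t\<in>{0..T}. \<forall>k.
               gradient u (\<sigma> t k) = gradient (value_function T h u g \<sigma> K t) k))
       \<and>
         (\<forall>V.
            C2_on ({0..T} \<times> UNIV) (\<lambda>(t, k). V t k) \<longrightarrow>
            satisfies_IE T h u f g i V \<longrightarrow>
            equilibrium_strategy T h u f g (\<lambda>t k. i (gradient (V t) k)))"
proof (rule conjI)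
  have h_cont: "continuous_on {0..} h"
    using h_deriv by (intro DERIV_continuous_on) auto
  note C1 = C2_on_imp_C1_on[OF u_C2] C2_on_imp_C1_on[OF g_C2] C2_on_imp_C1_on[OF f_C2]
  show "\<forall>\<sigma> K.
      continuous_on ({0..T} \<times> UNIV) (\<lambda>(t, k). \<sigma> t k) \<longrightarrow>
      (\<forall>t\<in>{0..T}. \<forall>k. \<sigma> t differentiable (at k)) \<longrightarrow>
      continuous_on ({0..T} \<times> UNIV) (\<lambda>(t, k). jacobian (\<sigma> t) (at k)) \<longrightarrow>
      is_flow T f \<sigma> K \<longrightarrow>
      equilibrium_strategy T h u f g \<sigma> \<longrightarrow>
      satisfies_IE T h u f g i (value_function T h u g \<sigma> K) \<and>
      (\<forall>t\<in>{0..T}. \<forall>k. gradient u (\<sigma> t k) = gradient (value_function T h u g \<sigma> K t) k)"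
  proof (intro allI impI)
    fix \<sigma> K
    assume \<sigma>_cont: "continuous_on ({0..T} \<times> UNIV) (\<lambda>(t, k). \<sigma> t k)"
      and \<sigma>_diff: "\<forall>t\<in>{0..T}. \<forall>k. \<sigma> t differentiable (at k)"
      and J_cont: "continuous_on ({0..T} \<times> UNIV) (\<lambda>(t, k). jacobian (\<sigma> t) (at k))"
      and flow: "is_flow T f \<sigma> K"
      and eq: "equilibrium_strategy T h u f g \<sigma>"
    interpret strategy_flow T h u g f \<sigma> "\<lambda>t k. matrix_blinfun (jacobian (\<sigma> t) (at k))" K
    proof
      show "continuous_on ({0..T} \<times> UNIV) (\<lambda>(t, k). matrix_blinfun (jacobian (\<sigma> t) (at k)))"
        using continuous_on_compose2[OF continuous_on_matrix_blinfun J_cont subset_UNIV]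
        by (simp add: case_prod_unfold)
      show "(\<sigma> t has_derivative blinfun_apply (matrix_blinfun (jacobian (\<sigma> t) (at k)))) (at k)"
        if "t \<in> {0..T}" for t k
        using \<sigma>_diff that by (simp add: matrix_blinfun_apply jacobian_works)
    qed (fact h_cont C1 \<sigma>_cont flow)+
    have foc: "gradient u (\<sigma> t k) = gradient (V t) k" if "t \<in> {0..T}" for t k
      by (rule equilibrium_first_order[OF eq that])
    then have strat: "i (gradient (V t) k) = \<sigma> t k" if "t \<in> {0..T}" for t k
      using i_inverse that by metis
    have path: "state_path T f (\<lambda>s x. i (gradient (V s) x)) t k k0 \<longleftrightarrow> state_path T f \<sigma> t k k0"
      if "t \<in> {0..T}" for t k k0
      unfolding state_path_def by (rule ivp_solution_cong) (use that in \<open>simp add: strat\<close>)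
    have "satisfies_IE T h u f g i V"
      unfolding satisfies_IE_def
    proof (intro conjI ballI allI impI)
      fix t k assume t: "t \<in> {0..T}"
      show "V t differentiable (at k)" by (rule value_function_differentiable[OF t])
      show "\<exists>k0. state_path T f (\<lambda>s x. i (gradient (V s) x)) t k k0"
        unfolding path[OF t] using state_path_flow[OF t] by blast
      fix k0 assume "state_path T f (\<lambda>s x. i (gradient (V s) x)) t k k0"
      then have k0: "state_path T f \<sigma> t k k0" by (simp add: path[OF t])
      have eq: "h (s - t) * u (i (gradient (V s) (k0 s))) = h (s - t) * u (\<sigma> s (k0 s))"
        if "s \<in> {t..T}" for s
        using that t by (simp add: strat)
      have integral_eq: "integral {t..T} (\<lambda>s. h (s - t) * u (i (gradient (V s) (k0 s)))) =
          integral {t..T} (\<lambda>s. h (s - t) * u (\<sigma> s (k0 s)))"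
        by (rule integral_cong) (rule eq)
      show "(\<lambda>s. h (s - t) * u (i (gradient (V s) (k0 s)))) integrable_on {t..T}"
        by (rule integrable_eq[OF value_along_path(1)[OF t k0]]) (simp add: eq)
      show "V t k = integral {t..T} (\<lambda>s. h (s - t) * u (i (gradient (V s) (k0 s))))
          + h (T - t) * g (k0 T)"
        unfolding value_along_path(2)[OF t k0] by (simp only: integral_eq)
    qed
    with foc show "satisfies_IE T h u f g i V \<and>
        (\<forall>t\<in>{0..T}. \<forall>k. gradient u (\<sigma> t k) = gradient (V t) k)"
      by blast
  qed
  show "\<forall>V. C2_on ({0..T} \<times> UNIV) (\<lambda>(t, k). V t k) \<longrightarrow> satisfies_IE T h u f g i V \<longrightarrow>
      equilibrium_strategy T h u f g (\<lambda>t k. i (gradient (V t) k))"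
  proof (intro allI impI)
    fix V assume V_C2: "C2_on ({0..T} \<times> UNIV) (\<lambda>(t, k). V t k)" and IE: "satisfies_IE T h u f g i V"
    let ?\<sigma> = "\<lambda>t k. i (gradient (V t) k)"
    have "C1_on ({0..T} \<times> UNIV) (\<lambda>(t, k). ?\<sigma> t k)"
      using C1_on_compose[OF C1_on_gradient[OF V_C2] i_C1] by (simp add: case_prod_unfold)
    note \<sigma>_cont = C1_on_continuous[OF this] and partial = C1_on_partial[OF this]
    obtain D\<sigma> where D\<sigma>: "continuous_on ({0..T} \<times> UNIV) (\<lambda>(t, k). D\<sigma> t k)"
      "\<And>t k. t \<in> {0..T} \<Longrightarrow> (?\<sigma> t has_derivative blinfun_apply (D\<sigma> t k)) (at k)"
      using partial by blast
    have "\<forall>t k. \<exists>k0. t \<in> {0..T} \<longrightarrow> state_path T f ?\<sigma> t k k0"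
      using IE unfolding satisfies_IE_def by blast
    then obtain k0 where "\<And>t k. t \<in> {0..T} \<Longrightarrow> state_path T f ?\<sigma> t k (k0 t k)"
      by metis
    then have flow: "is_flow T f ?\<sigma> (\<lambda>s t k. k0 t k s)"
      unfolding is_flow_def by simp
    interpret strategy_flow T h u g f ?\<sigma> D\<sigma> "\<lambda>s t k. k0 t k s"
      by unfold_locales (fact h_cont C1 \<sigma>_cont D\<sigma> flow)+
    have "V t k = value_function T h u g ?\<sigma> (\<lambda>s t k. k0 t k s) t k" if "t \<in> {0..T}" for t k
      using IE state_path_flow[OF that, of k] that
      unfolding satisfies_IE_def value_function_def by blast
    then have "V t = value_function T h u g ?\<sigma> (\<lambda>s t k. k0 t k s) t" if "t \<in> {0..T}" for t
      using that by blast
    moreover have "gradient u (?\<sigma> t k) = gradient (V t) k" for t k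
      using i_inverse by blast
    ultimately show "equilibrium_strategy T h u f g ?\<sigma>"
      by (intro equilibrium_if_first_order[OF u_concave]) metis
  qed
qed

end
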